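(* Let $\theta\in(0,1)$ and let $\eta,\xi\in\mathcal F_\theta(E^\infty,\mathbb R)$ with $\xi\ge0$. Suppose there exists a unique $\delta\in\mathbb R$ with $P(\eta-\delta\xi)=0$. Then the operator-valued map $z\mapsto(\mathrm{Id}-\mathcal L_{\eta+z\xi})^{-1}\in\mathcal B(\mathcal F_\theta^b(E^\infty))$ is holomorphic in the half-plane $\{z\in\mathbb C:\mathrm{Re}(z)<-\delta\}$.
   Context: Let $I\subset\mathbb N$ be an at most countable alphabet, $A\colon I\times I\to\{0,1\}$ an incidence matrix, $E^\infty=\{\omega\in I^{\mathbb N}: A_{\omega_j\omega_{j+1}}=1\ \forall j\ge 1\}$ with the subspace topology of the product of discrete topologies, $E^n$ the set of subwords of length $n$ of elements of $E^\infty$, $E^*=\bigcup_{n\ge0}E^n$ ($E^0$ contains only the empty word). Standing assumption: $A$ is finitely irreducible, i.e. there is a finite set $\Lambda\subset E^*$ such that for all $i,j\in I$ there is $\omega\in\Lambda$ with $i\omega j\in E^*$. $\sigma$ is the left shift on $E^\infty$; $[\omega]$ is the cylinder set of $\omega\in E^n$; $S_nf=\sum_{j=0}^{n-1}f\circ\sigma^j$. The pressure of $u\colon E^\infty\to\mathbb R$ is $P(u)=\lim_{n\to\infty}\frac1n\log\sum_{\omega\in E^n}\exp(\sup_{\tau\in[\omega]}S_nu(\tau))$. For continuous $f\colon E^\infty\to\mathbb C$, $\mathrm{var}_n(f)=\sup\{|f(x)-f(y)|: x_i=y_i\text{ for }i\le n\}$ and $\|f\|_\theta=\sup_{n\ge1}\mathrm{var}_n(f)/\theta^n$.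 $\mathcal F_\theta(E^\infty,\mathbb R)$: real continuous functions with $\|f\|_\theta<\infty$ (possibly unbounded). $\mathcal F_\theta^b(E^\infty)$: bounded continuous complex functions with $\|f\|_\theta<\infty$, a Banach space under $|\cdot|_\theta=\|\cdot\|_\theta+\|\cdot\|_\infty$; $\mathcal B(\mathcal F_\theta^b(E^\infty))$: bounded linear operators on it, with the operator norm. A real-valued $u\in\mathcal F_\theta(E^\infty,\mathbb R)$ is summable if $\sum_{e\in I}\exp(\sup(u|_{[e]}))<\infty$ (equivalently $P(u)<\infty$). For $f=u+\mathbf{i}v$ with $u,v\in\mathcal F_\theta(E^\infty,\mathbb R)$ and $u$ summable, $\mathcal L_f(g)(\omega)=\sum_{y:\sigma y=\omega}e^{f(y)}g(y)$. For $\mathrm{Re}(z)<t^*:=\sup\{t\in\mathbb R:\eta+t\xi\text{ is summable}\}$ (and $-\delta\le t^*$), $\mathcal L_{\eta+z\xi}\in\mathcal B(\mathcal F_\theta^b(E^\infty))$. *)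

theory Defs
  imports "HOL-Analysis.Analysis"
begin

section \<open>Symbolic space\<close>

text \<open>
  Infinite words are functions \<open>nat \<Rightarrow> nat\<close> with positions counted from \<open>0\<close>, so the first \<open>n\<close> letters
  sit at the positions \<open>i < n\<close>. The type \<open>nat \<Rightarrow> nat\<close> carries the product of the discrete topologies,
  and \<open>continuous_on\<close> refers to the induced subspace topology.
\<close>

definition code_space :: "nat set \<Rightarrow> (nat \<Rightarrow> nat \<Rightarrow> nat) \<Rightarrow> (nat \<Rightarrow> nat) set" where
  "code_space I A = {\<omega>. \<forall>j. \<omega> j \<in> I \<and> A (\<omega> j) (\<omega> (Suc j)) = 1}"

definition words :: "(nat \<Rightarrow> nat) set \<Rightarrow> nat \<Rightarrow> nat list set" where
  "words E n = {map \<tau> [k..<k + n] | \<tau> k. \<tau> \<in> E}"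

definition all_words :: "(nat \<Rightarrow> nat) set \<Rightarrow> nat list set" where
  "all_words E = (\<Union>n. words E n)"

definition finitely_irreducible :: "nat set \<Rightarrow> (nat \<Rightarrow> nat \<Rightarrow> nat) \<Rightarrow> bool" where
  "finitely_irreducible I A \<longleftrightarrow>
    (\<exists>\<Lambda>. finite \<Lambda> \<and> \<Lambda> \<subseteq> all_words (code_space I A) \<and>
      (\<forall>i\<in>I. \<forall>j\<in>I. \<exists>\<omega>\<in>\<Lambda>. i # \<omega> @ [j] \<in> all_words (code_space I A)))"

definition shift :: "(nat \<Rightarrow> nat) \<Rightarrow> nat \<Rightarrow> nat" where
  "shift \<omega> = (\<lambda>j. \<omega> (Suc j))"

definition cylinder :: "(nat \<Rightarrow> nat) set \<Rightarrow> nat list \<Rightarrow> (nat \<Rightarrow> nat) set" where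
  "cylinder E w = {\<tau> \<in> E. \<forall>i<length w. \<tau> i = w ! i}"

section \<open>Topological pressure\<close>

definition birkhoff_sum :: "nat \<Rightarrow> ((nat \<Rightarrow> nat) \<Rightarrow> real) \<Rightarrow> (nat \<Rightarrow> nat) \<Rightarrow> real" where
  "birkhoff_sum n f \<tau> = (\<Sum>j<n. f ((shift ^^ j) \<tau>))"

text \<open>
  The exponential and logarithm are extended to infinite values, because suprema over cylinders and
  the sum over all words may be infinite (and the latter is \<open>0\<close> on an empty space).
\<close>

definition exp_ext :: "ereal \<Rightarrow> ennreal" where
  "exp_ext x = (case x of ereal r \<Rightarrow> ennreal (exp r) | PInfty \<Rightarrow> \<infinity> | MInfty \<Rightarrow> 0)"

definition log_ext :: "ennreal \<Rightarrow> ereal" where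
  "log_ext x = (if x = 0 then - \<infinity> else if x = \<infinity> then \<infinity> else ereal (ln (enn2real x)))"

definition partition_sum :: "(nat \<Rightarrow> nat) set \<Rightarrow> ((nat \<Rightarrow> nat) \<Rightarrow> real) \<Rightarrow> nat \<Rightarrow> ennreal" where
  "partition_sum E u n =
    (\<Sum>\<^sub>\<infinity>w\<in>words E n. exp_ext (SUP \<tau>\<in>cylinder E w. ereal (birkhoff_sum n u \<tau>)))"

definition pressure :: "(nat \<Rightarrow> nat) set \<Rightarrow> ((nat \<Rightarrow> nat) \<Rightarrow> real) \<Rightarrow> ereal" where
  "pressure E u = lim (\<lambda>n. log_ext (partition_sum E u n) / ereal (real n))"

section \<open>Hoelder spaces\<close>

definition variation :: "(nat \<Rightarrow> nat) set \<Rightarrow> nat \<Rightarrow> ((nat \<Rightarrow> nat) \<Rightarrow> 'a::real_normed_vector) \<Rightarrow> ennreal" where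
  "variation E n f =
    (SUP (x, y) \<in> {(x, y). x \<in> E \<and> y \<in> E \<and> (\<forall>i<n. x i = y i)}. ennreal (norm (f x - f y)))"

definition holder_seminorm :: "(nat \<Rightarrow> nat) set \<Rightarrow> real \<Rightarrow> ((nat \<Rightarrow> nat) \<Rightarrow> 'a::real_normed_vector) \<Rightarrow> ennreal" where
  "holder_seminorm E \<theta> f = (SUP n\<in>{1..}. variation E n f / ennreal (\<theta> ^ n))"

definition supnorm :: "(nat \<Rightarrow> nat) set \<Rightarrow> ((nat \<Rightarrow> nat) \<Rightarrow> 'a::real_normed_vector) \<Rightarrow> ennreal" where
  "supnorm E f = (SUP x\<in>E. ennreal (norm (f x)))"

definition Holder_real :: "(nat \<Rightarrow> nat) set \<Rightarrow> real \<Rightarrow> ((nat \<Rightarrow> nat) \<Rightarrow> real) set" where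
  "Holder_real E \<theta> = {f. continuous_on E f \<and> holder_seminorm E \<theta> f < \<infinity>}"

text \<open>
  An element of the Banach space of bounded Hoelder functions on \<open>E\<close> is represented by its extension
  by zero to the whole type, so that the representation is unique and the space is a complex linear
  subspace of the function type.
\<close>

definition Holder_bdd :: "(nat \<Rightarrow> nat) set \<Rightarrow> real \<Rightarrow> ((nat \<Rightarrow> nat) \<Rightarrow> complex) set" where
  "Holder_bdd E \<theta> =
    {f. (\<forall>x. x \<notin> E \<longrightarrow> f x = 0) \<and> continuous_on E f \<and>
        holder_seminorm E \<theta> f < \<infinity> \<and> supnorm E f < \<infinity>}"

definition holder_norm :: "(nat \<Rightarrow> nat) set \<Rightarrow> real \<Rightarrow> ((nat \<Rightarrow> nat) \<Rightarrow> complex) \<Rightarrow> real" where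
  "holder_norm E \<theta> f = enn2real (holder_seminorm E \<theta> f + supnorm E f)"

section \<open>Bounded operators on the space of bounded Hoelder functions\<close>

type_synonym operator = "((nat \<Rightarrow> nat) \<Rightarrow> complex) \<Rightarrow> (nat \<Rightarrow> nat) \<Rightarrow> complex"

text \<open>
  The space depends on \<open>E\<close> and \<open>\<theta>\<close> and hence is not a type. Operators are functions on the ambient
  function type of which only the values on \<open>Holder_bdd E \<theta>\<close> matter.
\<close>

definition bdd_operators :: "(nat \<Rightarrow> nat) set \<Rightarrow> real \<Rightarrow> operator set" where
  "bdd_operators E \<theta> =
    {T. (\<forall>g\<in>Holder_bdd E \<theta>. T g \<in> Holder_bdd E \<theta>) \<and>
        (\<forall>g\<in>Holder_bdd E \<theta>. \<forall>h\<in>Holder_bdd E \<theta>. T (\<lambda>x. g x + h x) = (\<lambda>x. T g x + T h x)) \<and>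
        (\<forall>c. \<forall>g\<in>Holder_bdd E \<theta>. T (\<lambda>x. c * g x) = (\<lambda>x. c * T g x)) \<and>
        (\<exists>C. \<forall>g\<in>Holder_bdd E \<theta>. holder_norm E \<theta> (T g) \<le> C * holder_norm E \<theta> g)}"

text \<open>The supremum below is meaningful for \<open>T \<in> bdd_operators E \<theta>\<close>, where it is over a bounded set.\<close>

definition operator_norm :: "(nat \<Rightarrow> nat) set \<Rightarrow> real \<Rightarrow> operator \<Rightarrow> real" where
  "operator_norm E \<theta> T =
    (SUP g\<in>{g \<in> Holder_bdd E \<theta>. holder_norm E \<theta> g \<le> 1}. holder_norm E \<theta> (T g))"

definition invertible_operator :: "(nat \<Rightarrow> nat) set \<Rightarrow> real \<Rightarrow> operator \<Rightarrow> bool" where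
  "invertible_operator E \<theta> T \<longleftrightarrow>
    T \<in> bdd_operators E \<theta> \<and>
    (\<exists>R\<in>bdd_operators E \<theta>. \<forall>g\<in>Holder_bdd E \<theta>. R (T g) = g \<and> T (R g) = g)"

definition inverse_operator :: "(nat \<Rightarrow> nat) set \<Rightarrow> real \<Rightarrow> operator \<Rightarrow> operator" where
  "inverse_operator E \<theta> T = inv_into (Holder_bdd E \<theta>) T"

text \<open>
  Complex differentiability in operator norm at every point of \<open>D\<close>; this is the usual notion of a
  holomorphic operator-valued map when \<open>D\<close> is open.
\<close>

definition operator_holomorphic_on ::
    "(nat \<Rightarrow> nat) set \<Rightarrow> real \<Rightarrow> (complex \<Rightarrow> operator) \<Rightarrow> complex set \<Rightarrow> bool" where
  "operator_holomorphic_on E \<theta> R D \<longleftrightarrow>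
    (\<forall>z\<in>D. R z \<in> bdd_operators E \<theta>) \<and>
    (\<forall>z\<^sub>0\<in>D. \<exists>R'\<in>bdd_operators E \<theta>.
      ((\<lambda>z. operator_norm E \<theta> (\<lambda>g x. (R z g x - R z\<^sub>0 g x) / (z - z\<^sub>0) - R' g x)) \<longlongrightarrow> 0)
        (at z\<^sub>0 within D))"

section \<open>Transfer operator\<close>

definition transfer_operator :: "(nat \<Rightarrow> nat) set \<Rightarrow> ((nat \<Rightarrow> nat) \<Rightarrow> complex) \<Rightarrow> operator" where
  "transfer_operator E f g \<omega> = (\<Sum>\<^sub>\<infinity>y\<in>{y \<in> E. shift y = \<omega>}. exp (f y) * g y)"

definition id_minus_transfer ::
    "(nat \<Rightarrow> nat) set \<Rightarrow> ((nat \<Rightarrow> nat) \<Rightarrow> real) \<Rightarrow> ((nat \<Rightarrow> nat) \<Rightarrow> real) \<Rightarrow> complex \<Rightarrow> operator" where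
  "id_minus_transfer E \<eta> \<xi> z =
    (\<lambda>g \<omega>. g \<omega> - transfer_operator E (\<lambda>y. complex_of_real (\<eta> y) + z * complex_of_real (\<xi> y)) g \<omega>)"

end

theory Submission
  imports Defs
begin

text \<open>
  Write \<open>Z\<^sub>n(t)\<close> for the partition sums of the potential \<open>\<eta> + t\<xi>\<close> and \<open>L\<^sub>z\<close> for the transfer operator of
  \<open>\<eta> + z\<xi>\<close>. The half-plane \<open>Re z < -\<delta>\<close> lies where the pressure is negative: \<open>\<xi> \<ge> 0\<close> makes the pressure
  of \<open>\<eta> + t\<xi>\<close> nondecreasing in \<open>t\<close>, so for \<open>t < -\<delta>\<close> it is at most \<open>0\<close>, and it is not \<open>0\<close> because the zero is
  unique. Negative pressure means that \<open>Z\<^sub>n(t)\<close> decays exponentially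
  (\<open>summable_below_unique_zero\<close>).

  The iterate \<open>L\<^sub>z\<^sup>n g\<close> at a point \<open>x\<close> is a sum over the preimages of \<open>x\<close> under the \<open>n\<close>-th power of the
  shift, one for each word that may precede \<open>x\<close>, weighted by the exponential of a Birkhoff sum. Comparing
  this sum term by term at two points with the same first letter gives
  \<open>\<parallel>L\<^sub>z\<^sup>n\<parallel> \<le> C Z\<^sub>n(t)\<close> whenever \<open>Re z \<le> t\<close>, where \<open>C\<close> depends only on a bound for \<open>|z|\<close>
  (\<open>kernel_op_bounded\<close>, \<open>transfer_funpow_bounded\<close>). Hence the Neumann series of \<open>L\<^sub>z\<close>
  converges to an inverse of \<open>Id - L\<^sub>z\<close>, with a bound that is uniform for \<open>z\<close> near a given point
  (\<open>neumann_series\<close>).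

  It remains to differentiate. The map \<open>z \<mapsto> L\<^sub>z\<close> is differentiable in operator norm, with derivative
  \<open>g \<mapsto> L\<^sub>z(\<xi>g)\<close>, although \<open>\<xi>\<close> may be unbounded: powers of \<open>\<xi>\<close> are dominated by \<open>exp(\<epsilon>\<xi>)\<close>, which only
  moves \<open>Re z\<close> to the right by \<open>\<epsilon>\<close>, and there is room for this to the left of \<open>-\<delta>\<close>
  (\<open>weighted_transfer_bounded\<close>, \<open>transfer_differentiable\<close>). The inverse then inherits differentiability
  from the resolvent identity (\<open>resolvent_derivative\<close>).
\<close>

section \<open>Subadditive sequences and exponentials\<close>

text \<open>
  Dividing \<open>n\<close> by a fixed \<open>m\<close> with remainder bounds \<open>a n / n\<close> by \<open>a m / m\<close> up to an error of order \<open>1 / n\<close>,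
  so the upper limit is at most the infimum. The limit is taken in the extended reals because the
  infimum may be \<open>-\<infinity>\<close>. A pressure defined by \<^const>\<open>lim\<close> carries information only once this limit is
  known to exist.
\<close>

lemma fekete_ereal:
  fixes a :: "nat \<Rightarrow> real"
  assumes sub: "\<And>m n. a (m + n) \<le> a m + a n"
  shows "\<exists>L::ereal. (\<lambda>n. ereal (a n / real n)) \<longlonglongrightarrow> L"
proof -
  define L where "L = (INF n\<in>{1..}. ereal (a n / real n))"
  have iter: "a (q * m + r) \<le> real q * a m + a r" for q m r
  proof (induction q)
    case (Suc q)
    have "a (Suc q * m + r) \<le> a m + a (q * m + r)"
      using sub[of m "q * m + r"] by (simp add: algebra_simps)
    with Suc show ?case by (simp add: algebra_simps)
  qed simp
  have upper: "limsup (\<lambda>n. ereal (a n / real n)) \<le> ereal (a m / real m)" if m: "m \<ge> 1" for m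
  proof -
    \<comment> \<open>a bound for the contribution of all possible remainders modulo \<open>m\<close>\<close>
    define M where "M = (\<Sum>r<m. \<bar>a r\<bar>)"
    have bound: "a n / real n \<le> a m / real m + (\<bar>a m\<bar> + M) / real n" if n: "n \<ge> 1" for n
    proof -
      have r: "n mod m < m" using m by simp
      have "a n \<le> real (n div m) * a m + a (n mod m)"
        using iter[of "n div m" m "n mod m"] by simp
      moreover have "a (n mod m) \<le> M"
      proof -
        have "\<bar>a (n mod m)\<bar> \<le> M"
          unfolding M_def by (rule member_le_sum) (use r in auto)
        then show ?thesis by linarith
      qed
      moreover have "real (n div m) * a m \<le> real n * (a m / real m) + \<bar>a m\<bar>"
      proof -
        have e: "real n = real (n div m) * real m + real (n mod m)"
          by (metis div_mult_mod_eq of_nat_add of_nat_mult)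
        have eq: "real n * (a m / real m) = real (n div m) * a m + real (n mod m) / real m * a m"
          unfolding e using m by (simp add: field_simps)
        have "\<bar>real (n mod m) / real m * a m\<bar> \<le> 1 * \<bar>a m\<bar>"
          unfolding abs_mult by (rule mult_right_mono) (use r m in \<open>auto simp: field_simps\<close>)
        then have "- (real (n mod m) / real m * a m) \<le> \<bar>a m\<bar>"
          by (simp only: mult_1_left abs_le_iff)
        then show ?thesis unfolding eq by argo
      qed
      ultimately have "a n \<le> real n * (a m / real m) + (\<bar>a m\<bar> + M)" by linarith
      then have "a n / real n \<le> (real n * (a m / real m) + (\<bar>a m\<bar> + M)) / real n"
        using n by (intro divide_right_mono) auto
      then show ?thesis using n by (simp add: add_divide_distrib)
    qed
    have "(\<lambda>n. a m / real m + (\<bar>a m\<bar> + M) / real n) \<longlonglongrightarrow> a m / real m + 0"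
      by (intro tendsto_intros lim_const_over_n)
    then have "limsup (\<lambda>n. ereal (a m / real m + (\<bar>a m\<bar> + M) / real n)) = ereal (a m / real m)"
      by (intro lim_imp_Limsup) auto
    moreover have "limsup (\<lambda>n. ereal (a n / real n))
        \<le> limsup (\<lambda>n. ereal (a m / real m + (\<bar>a m\<bar> + M) / real n))"
      by (intro Limsup_mono eventually_sequentiallyI[of 1]) (use bound in auto)
    ultimately show ?thesis by simp
  qed
  have "limsup (\<lambda>n. ereal (a n / real n)) \<le> L"
    unfolding L_def by (rule INF_greatest) (use upper in auto)
  moreover have "L \<le> liminf (\<lambda>n. ereal (a n / real n))"
    by (rule Liminf_bounded, rule eventually_sequentiallyI[of 1]) (auto simp: L_def intro: INF_lower)
  ultimately have "(\<lambda>n. ereal (a n / real n)) \<longlonglongrightarrow> L"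
    using Liminf_le_Limsup[OF trivial_limit_sequentially, of "\<lambda>n. ereal (a n / real n)"]
    by (intro Liminf_eq_Limsup) auto
  then show ?thesis by blast
qed

text \<open>
  The mean value inequality on a half-plane. Only a common upper bound \<open>m\<close> of the real parts enters, so the
  supremum of a Birkhoff sum over a cylinder can be used for \<open>m\<close>.
\<close>

lemma norm_exp_diff_le:
  fixes a b :: complex
  assumes "Re a \<le> m" "Re b \<le> m"
  shows "norm (exp a - exp b) \<le> norm (a - b) * exp m"
proof -
  have "norm (exp a - exp b) \<le> exp m * norm (a - b)"
  proof (rule field_differentiable_bound[where S = "{z. Re z \<le> m}" and f' = exp])
    show "convex {z. Re z \<le> m}" by (rule convex_halfspace_Re_le)
  qed (use assms in \<open>auto intro!: derivative_eq_intros\<close>)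
  then show ?thesis by (simp add: mult.commute)
qed

text \<open>
  The remainder \<open>exp (h s) - 1 - h s\<close> has \<open>s\<close>-derivative \<open>h (exp (h s) - 1)\<close>, which is of size
  \<open>\<bar>h\<bar>\<^sup>2 s exp (\<bar>h\<bar> s)\<close>; the factor \<open>s\<close> is absorbed by \<open>s \<le> exp (r s) / r\<close>. The bound is quadratic in \<open>h\<close>, as
  a derivative in operator norm requires, and its growth in \<open>s\<close> is exponential with a small rate.
\<close>

lemma exp_remainder_lipschitz:
  fixes h :: complex and s s' r :: real
  assumes s: "0 \<le> s" "0 \<le> s'" and h: "norm h \<le> r" and r: "0 < r"
  shows "norm ((exp (h * of_real s) - 1 - h * of_real s) - (exp (h * of_real s') - 1 - h * of_real s'))
    \<le> norm h ^ 2 / r * \<bar>s - s'\<bar> * exp (2 * r * max s s')"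
proof -
  define M where "M = max s s'"
  have M: "0 \<le> M" "\<bar>s\<bar> \<le> M" "\<bar>s'\<bar> \<le> M" using s by (auto simp: M_def)
  have "norm ((exp (h * of_real s) - 1 - h * of_real s) - (exp (h * of_real s') - 1 - h * of_real s'))
    \<le> (norm h ^ 2 / r * exp (2 * r * M)) * norm (of_real s - of_real s' :: complex)"
  proof (rule field_differentiable_bound[where S = "cball 0 M" and f = "\<lambda>w. exp (h * w) - 1 - h * w"
        and f' = "\<lambda>w. h * (exp (h * w) - 1)"])
    fix w :: complex assume w: "w \<in> cball 0 M"
    have hw: "norm (h * w) \<le> norm h * M"
      using w by (simp add: norm_mult mult_left_mono)
    have rM: "norm h * M \<le> r * M" using h M by (intro mult_right_mono)
    have "norm (exp (h * w) - exp 0) \<le> norm (h * w - 0) * exp (norm h * M)"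
      by (rule norm_exp_diff_le) (use hw M complex_Re_le_cmod[of "h * w"] in auto)
    also have "\<dots> \<le> (norm h * M) * exp (r * M)"
      by (rule mult_mono) (use hw rM M in auto)
    also have "\<dots> \<le> (norm h * (exp (r * M) / r)) * exp (r * M)"
    proof -
      have "r * M \<le> exp (r * M)" using exp_ge_add_one_self[of "r * M"] by linarith
      then have "M \<le> exp (r * M) / r" using r by (simp add: field_simps)
      then show ?thesis by (intro mult_right_mono mult_left_mono) auto
    qed
    also have "\<dots> = norm h / r * exp (2 * r * M)"
      by (simp add: exp_add[symmetric] algebra_simps)
    finally have "norm h * norm (exp (h * w) - 1) \<le> norm h * (norm h / r * exp (2 * r * M))"
      by (intro mult_left_mono) auto
    then show "norm (h * (exp (h * w) - 1)) \<le> norm h ^ 2 / r * exp (2 * r * M)"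
      by (simp add: norm_mult power2_eq_square)
  qed (use M in \<open>auto intro!: derivative_eq_intros simp: algebra_simps\<close>)
  also have "norm (of_real s - of_real s' :: complex) = \<bar>s - s'\<bar>"
    by (metis norm_of_real of_real_diff)
  finally show ?thesis by (simp add: M_def mult_ac)
qed

text \<open>
  The exponential is increasing and continuous up to infinite values. Both sides are \<open>0\<close> if \<open>C\<close> is empty.
\<close>

lemma exp_ext_SUP:
  "exp_ext (SUP \<tau>\<in>C. ereal (g \<tau>)) = (SUP \<tau>\<in>C. ennreal (exp (g \<tau>)))"
proof (rule antisym)
  let ?S = "SUP \<tau>\<in>C. ereal (g \<tau>)" and ?T = "SUP \<tau>\<in>C. ennreal (exp (g \<tau>))"
  have mono: "exp_ext x \<le> exp_ext y" if "x \<le> y" for x y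
    using that by (cases x; cases y) (auto simp: exp_ext_def)
  show "?T \<le> exp_ext ?S"
  proof (rule SUP_least)
    fix \<tau> assume "\<tau> \<in> C"
    then have "exp_ext (ereal (g \<tau>)) \<le> exp_ext ?S" by (intro mono SUP_upper)
    then show "ennreal (exp (g \<tau>)) \<le> exp_ext ?S" by (simp add: exp_ext_def)
  qed
  show "exp_ext ?S \<le> ?T"
  proof (cases "C = {}")
    case True then show ?thesis by (simp add: exp_ext_def bot_ereal_def)
  next
    case False
    then obtain \<tau>0 where \<tau>0: "\<tau>0 \<in> C" by blast
    show ?thesis
    proof (cases ?T)
      case (real c)
      have le: "exp (g \<tau>) \<le> c" if "\<tau> \<in> C" for \<tau>
        using SUP_upper[OF that, of "\<lambda>\<tau>. ennreal (exp (g \<tau>))"] real by simp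
      have c: "0 < c" using le[OF \<tau>0] exp_gt_zero[of "g \<tau>0"] by linarith
      have "g \<tau> \<le> ln c" if "\<tau> \<in> C" for \<tau>
        using le[OF that] c by (simp add: ln_ge_iff)
      then have "?S \<le> ereal (ln c)" by (intro SUP_least) auto
      then have "exp_ext ?S \<le> exp_ext (ereal (ln c))" by (rule mono)
      then show ?thesis using c real by (simp add: exp_ext_def)
    next
      case top
      show ?thesis unfolding top by (rule top_greatest)
    qed
  qed
qed

section \<open>Words and partition sums\<close>

definition initial_word :: "nat \<Rightarrow> (nat \<Rightarrow> nat) \<Rightarrow> nat list" where
  "initial_word n y = map y [0..<n]"

definition glue :: "nat list \<Rightarrow> (nat \<Rightarrow> nat) \<Rightarrow> nat \<Rightarrow> nat" where
  "glue w x = (\<lambda>i. if i < length w then w ! i else x (i - length w))"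

lemma length_initial_word [simp]: "length (initial_word n y) = n"
  by (simp add: initial_word_def)

lemma nth_initial_word [simp]: "i < n \<Longrightarrow> initial_word n y ! i = y i"
  by (simp add: initial_word_def)

lemma initial_word_eq_iff: "initial_word n x = initial_word n y \<longleftrightarrow> (\<forall>i<n. x i = y i)"
  by (auto simp: initial_word_def map_eq_conv)

lemma shift_pow: "(shift ^^ n) y = (\<lambda>i. y (i + n))"
  by (induction n arbitrary: y) (auto simp: shift_def fun_eq_iff funpow_swap1)

lemma glue_initial_shift: "glue (initial_word n y) ((shift ^^ n) y) = y"
  by (auto simp: glue_def shift_pow fun_eq_iff)

lemma shift_glue: "length w = n \<Longrightarrow> (shift ^^ n) (glue w x) = x"
  by (auto simp: glue_def shift_pow fun_eq_iff)

lemma initial_word_glue [simp]: "length w = n \<Longrightarrow> initial_word n (glue w x) = w"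
  by (auto simp: glue_def intro!: nth_equalityI)

definition word_weight :: "(nat \<Rightarrow> nat) set \<Rightarrow> ((nat \<Rightarrow> nat) \<Rightarrow> real) \<Rightarrow> nat \<Rightarrow> nat list \<Rightarrow> ennreal" where
  "word_weight E u n w = (SUP \<tau>\<in>cylinder E w. ennreal (exp (birkhoff_sum n u \<tau>)))"

lemma partition_sum_eq: "partition_sum E u n = (\<Sum>\<^sub>\<infinity>w\<in>words E n. word_weight E u n w)"
  by (simp add: partition_sum_def word_weight_def exp_ext_SUP)

lemma mem_cylinder_initial_word: "y \<in> E \<Longrightarrow> y \<in> cylinder E (initial_word n y)"
  by (simp add: cylinder_def)

lemma exp_birkhoff_le_word_weight:
  "y \<in> E \<Longrightarrow> ennreal (exp (birkhoff_sum n u y)) \<le> word_weight E u n (initial_word n y)"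
  unfolding word_weight_def by (rule SUP_upper[OF mem_cylinder_initial_word])

lemma sum_le_infsum_ennreal:
  fixes f :: "'a \<Rightarrow> ennreal"
  assumes "finite F" "F \<subseteq> A"
  shows "sum f F \<le> infsum f A"
proof -
  have "sum f F = infsum f F" using assms by simp
  also have "\<dots> \<le> infsum f A" by (rule infsum_mono_neutral) (use assms in \<open>auto intro: nonneg_summable_on_complete\<close>)
  finally show ?thesis .
qed

text \<open>
  Comparison of two partition sums whose terms are matched by an injection of words.
\<close>

lemma infsum_le_of_inj_on:
  fixes f :: "'a \<Rightarrow> ennreal" and g :: "'b \<Rightarrow> ennreal"
  assumes inj: "inj_on \<phi> A" and img: "\<phi> ` A \<subseteq> B" and le: "\<And>w. w \<in> A \<Longrightarrow> f w \<le> K * g (\<phi> w)"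
  shows "infsum f A \<le> K * infsum g B"
proof (rule infsum_le_finite_sums)
  fix F assume F: "finite F" "F \<subseteq> A"
  have "sum f F \<le> (\<Sum>w\<in>F. K * g (\<phi> w))" by (rule sum_mono) (use F le in auto)
  also have "\<dots> = K * sum g (\<phi> ` F)"
    using inj_on_subset[OF inj F(2)] by (simp add: sum_distrib_left sum.reindex)
  also have "\<dots> \<le> K * infsum g B"
    by (intro mult_left_mono sum_le_infsum_ennreal) (use F img in auto)
  finally show "sum f F \<le> K * infsum g B" .
qed (simp add: nonneg_summable_on_complete)

lemma birkhoff_sum_add:
  "birkhoff_sum (m + n) u y = birkhoff_sum m u y + birkhoff_sum n u ((shift ^^ m) y)"
proof -
  have "(\<Sum>j<m + n. u ((shift ^^ j) y)) = (\<Sum>j<m. u ((shift ^^ j) y)) + (\<Sum>j<n. u ((shift ^^ (m + j)) y))"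
    by (induction n) (auto simp: algebra_simps)
  then show ?thesis by (simp add: birkhoff_sum_def shift_pow algebra_simps)
qed

locale code_shift =
  fixes I :: "nat set" and A :: "nat \<Rightarrow> nat \<Rightarrow> nat" and E :: "(nat \<Rightarrow> nat) set"
  assumes E_def: "E = code_space I A"
begin

lemma mem_E_iff: "y \<in> E \<longleftrightarrow> (\<forall>j. y j \<in> I \<and> A (y j) (y (Suc j)) = 1)"
  by (simp add: E_def code_space_def)

lemma shift_pow_mem: "y \<in> E \<Longrightarrow> (shift ^^ n) y \<in> E"
  by (simp add: mem_E_iff shift_pow)

text \<open>
  Appending the first letter of \<open>x\<close> to \<open>w\<close> expresses all transitions inside \<open>w\<close> and the one from \<open>w\<close> to \<open>x\<close>
  at once.
\<close>

lemma glue_mem: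
  assumes x: "x \<in> E" and I: "\<And>i. i < length w \<Longrightarrow> w ! i \<in> I"
    and A: "\<And>i. i < length w \<Longrightarrow> A (w ! i) ((w @ [x 0]) ! Suc i) = 1"
  shows "glue w x \<in> E"
  unfolding mem_E_iff
proof (intro allI conjI)
  fix j
  show "glue w x j \<in> I" using x I by (auto simp: glue_def mem_E_iff)
  show "A (glue w x j) (glue w x (Suc j)) = 1"
  proof (cases "j < length w")
    case True
    have "(w @ [x 0]) ! Suc j = glue w x (Suc j)"
      using True by (cases "Suc j < length w") (auto simp: glue_def nth_append)
    then show ?thesis using A[OF True] True by (simp add: glue_def)
  next
    case False
    then have "Suc j - length w = Suc (j - length w)" by simp
    then show ?thesis using False x by (auto simp: glue_def mem_E_iff)
  qed
qed

lemma glue_initial_word_mem: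
  assumes "y \<in> E" "x \<in> E" "y n = x 0"
  shows "glue (initial_word n y) x \<in> E"
proof (rule glue_mem)
  fix i assume i: "i < length (initial_word n y)"
  show "initial_word n y ! i \<in> I" using i assms(1) by (simp add: mem_E_iff)
  have "(initial_word n y @ [x 0]) ! Suc i = y (Suc i)"
    using i assms(3) by (cases "Suc i = n") (auto simp: nth_append)
  then show "A (initial_word n y ! i) ((initial_word n y @ [x 0]) ! Suc i) = 1"
    using i assms(1) by (simp add: mem_E_iff)
qed fact

text \<open>
  The code space is invariant under the shift, so a subword at any position is also an initial word.
\<close>

lemma words_eq: "words E n = initial_word n ` E"
proof -
  have shifted: "map \<tau> [k..<k + n] = initial_word n ((shift ^^ k) \<tau>)" for \<tau> k
    by (intro nth_equalityI) (auto simp: shift_pow initial_word_def algebra_simps)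
  show ?thesis
  proof
    show "words E n \<subseteq> initial_word n ` E"
      using shift_pow_mem by (auto simp: words_def shifted)
    show "initial_word n ` E \<subseteq> words E n"
    proof
      fix w assume "w \<in> initial_word n ` E"
      then obtain \<tau> where "\<tau> \<in> E" "w = map \<tau> [0..<0 + n]" by (auto simp: initial_word_def)
      then show "w \<in> words E n" unfolding words_def by blast
    qed
  qed
qed

lemma word_weight_add_le:
  assumes "w \<in> words E (m + n)"
  shows "word_weight E u (m + n) w \<le> word_weight E u m (take m w) * word_weight E u n (drop m w)"
  unfolding word_weight_def[of E u "m + n"]
proof (rule SUP_least)
  fix \<tau> assume \<tau>: "\<tau> \<in> cylinder E w"
  have len: "length w = m + n" using assms by (auto simp: words_eq)
  have t: "\<tau> \<in> cylinder E (take m w)" "(shift ^^ m) \<tau> \<in> cylinder E (drop m w)"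
    using \<tau> len shift_pow_mem[of \<tau> m] by (auto simp: cylinder_def shift_pow add.commute)
  have "ennreal (exp (birkhoff_sum (m + n) u \<tau>))
      = ennreal (exp (birkhoff_sum m u \<tau>)) * ennreal (exp (birkhoff_sum n u ((shift ^^ m) \<tau>)))"
    by (simp add: birkhoff_sum_add exp_add ennreal_mult)
  also have "\<dots> \<le> word_weight E u m (take m w) * word_weight E u n (drop m w)"
    unfolding word_weight_def by (intro mult_mono SUP_upper t) auto
  finally show "ennreal (exp (birkhoff_sum (m + n) u \<tau>))
      \<le> word_weight E u m (take m w) * word_weight E u n (drop m w)" .
qed

text \<open>
  Cutting a word of length \<open>m + n\<close> after \<open>m\<close> letters is injective, and the supremum of a Birkhoff sum over
  its cylinder is at most the sum of the suprema over the cylinders of the two pieces.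
\<close>

lemma partition_sum_add_le:
  "partition_sum E u (m + n) \<le> partition_sum E u m * partition_sum E u n"
  unfolding partition_sum_eq
proof (rule infsum_le_finite_sums)
  fix F assume F: "finite F" "F \<subseteq> words E (m + n)"
  let ?split = "\<lambda>w :: nat list. (take m w, drop m w)"
  have inj: "inj_on ?split F" by (rule inj_onI) (metis Pair_inject append_take_drop_id)
  have sub: "take m ` F \<subseteq> words E m" "drop m ` F \<subseteq> words E n"
  proof -
    have "take m (initial_word (m + n) \<tau>) = initial_word m \<tau>"
      "drop m (initial_word (m + n) \<tau>) = initial_word n ((shift ^^ m) \<tau>)" for \<tau>
      by (auto intro!: nth_equalityI simp: shift_pow add.commute)
    then show "take m ` F \<subseteq> words E m" "drop m ` F \<subseteq> words E n"
      using F(2) shift_pow_mem by (fastforce simp: words_eq)+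
  qed
  have "sum (word_weight E u (m + n)) F
      \<le> (\<Sum>w\<in>F. word_weight E u m (take m w) * word_weight E u n (drop m w))"
    by (intro sum_mono word_weight_add_le) (use F in auto)
  also have "\<dots> = (\<Sum>(v, w)\<in>?split ` F. word_weight E u m v * word_weight E u n w)"
    by (simp add: sum.reindex[OF inj])
  also have "\<dots> \<le> (\<Sum>(v, w)\<in>take m ` F \<times> drop m ` F. word_weight E u m v * word_weight E u n w)"
    by (rule sum_mono2) (use F in auto)
  also have "\<dots> = sum (word_weight E u m) (take m ` F) * sum (word_weight E u n) (drop m ` F)"
    by (simp add: sum_product sum.cartesian_product)
  also have "\<dots> \<le> (\<Sum>\<^sub>\<infinity>w\<in>words E m. word_weight E u m w) * (\<Sum>\<^sub>\<infinity>w\<in>words E n. word_weight E u n w)"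
    by (intro mult_mono sum_le_infsum_ennreal) (use F sub in auto)
  finally show "sum (word_weight E u (m + n)) F
      \<le> (\<Sum>\<^sub>\<infinity>w\<in>words E m. word_weight E u m w) * (\<Sum>\<^sub>\<infinity>w\<in>words E n. word_weight E u n w)" .
qed (simp add: nonneg_summable_on_complete)

lemma partition_sum_finite:
  assumes "partition_sum E u 1 \<noteq> \<infinity>"
  shows "partition_sum E u n \<noteq> \<infinity>"
proof (cases n)
  case 0
  have "infsum (word_weight E u 0) (words E 0) \<le> 1"
  proof (rule infsum_le_finite_sums)
    fix F assume F: "finite F" "F \<subseteq> words E 0"
    have "sum (word_weight E u 0) F \<le> sum (\<lambda>_. 1) F"
      by (intro sum_mono) (auto simp: word_weight_def birkhoff_sum_def intro!: SUP_least)
    also have "\<dots> \<le> 1"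
    proof -
      have "F \<subseteq> {[]}" using F by (auto simp: words_eq initial_word_def)
      then have "card F \<le> card {[] :: nat list}" by (intro card_mono) auto
      then show ?thesis by (simp add: order.trans[OF of_nat_mono])
    qed
    finally show "sum (word_weight E u 0) F \<le> 1" .
  qed (simp add: nonneg_summable_on_complete)
  then show ?thesis using 0 by (auto simp: partition_sum_eq top_unique)
next
  case (Suc m)
  have "partition_sum E u (Suc m) \<noteq> \<infinity>" for m
  proof (induction m)
    case (Suc m)
    have "partition_sum E u 1 * partition_sum E u (Suc m) < \<infinity>"
      using assms Suc by (auto simp: ennreal_mult_less_top less_top)
    then show ?case using partition_sum_add_le[of u 1 "Suc m"] by (auto simp: top_unique)
  qed (use assms in simp)
  then show ?thesis using Suc by simp
qed

lemma partition_sum_pos: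
  assumes "E \<noteq> {}"
  shows "0 < partition_sum E u n"
proof -
  obtain y where y: "y \<in> E" using assms by blast
  have "0 < ennreal (exp (birkhoff_sum n u y))" by simp
  also have "\<dots> \<le> word_weight E u n (initial_word n y)" by (rule exp_birkhoff_le_word_weight[OF y])
  also have "\<dots> = sum (word_weight E u n) {initial_word n y}" by simp
  also have "\<dots> \<le> partition_sum E u n"
    unfolding partition_sum_eq by (rule sum_le_infsum_ennreal) (use y in \<open>auto simp: words_eq\<close>)
  finally show ?thesis .
qed

text \<open>
  By submultiplicativity the logarithms are finite and subadditive as soon as the first partition sum is finite,
  and Fekete's lemma applies.
\<close>

lemma pressure_tendsto:
  assumes E: "E \<noteq> {}" and fin: "partition_sum E u 1 \<noteq> \<infinity>"
  shows "(\<lambda>n. ereal (ln (enn2real (partition_sum E u n)) / real n)) \<longlonglongrightarrow> pressure E u"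
proof -
  let ?z = "\<lambda>n. enn2real (partition_sum E u n)"
  have z: "partition_sum E u n = ennreal (?z n)" "0 < ?z n" for n
    using partition_sum_finite[OF fin, of n] partition_sum_pos[OF E, of u n]
    by (auto simp: enn2real_positive_iff less_top)
  have "ln (?z (m + n)) \<le> ln (?z m) + ln (?z n)" for m n
  proof -
    have "ennreal (?z (m + n)) \<le> ennreal (?z m * ?z n)"
      using partition_sum_add_le[of u m n] z by (simp add: ennreal_mult)
    then have "?z (m + n) \<le> ?z m * ?z n" by (simp add: less_imp_le z(2))
    then have "ln (?z (m + n)) \<le> ln (?z m * ?z n)" using z(2) by (simp add: ln_mono)
    then show ?thesis using z(2)[of m] z(2)[of n] by (simp add: ln_mult)
  qed
  then obtain L where L: "(\<lambda>n. ereal (ln (?z n) / real n)) \<longlonglongrightarrow> L"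
    using fekete_ereal[of "\<lambda>n. ln (?z n)"] by blast
  have "(\<lambda>n. log_ext (partition_sum E u n) / ereal (real n)) \<longlonglongrightarrow> L"
  proof (rule Lim_transform_eventually[OF L])
    show "\<forall>\<^sub>F n in sequentially. ereal (ln (?z n) / real n) = log_ext (partition_sum E u n) / ereal (real n)"
    proof (rule eventually_sequentiallyI[of 1])
      fix n :: nat assume n: "1 \<le> n"
      have "log_ext (partition_sum E u n) = ereal (ln (?z n))"
        using partition_sum_finite[OF fin, of n] partition_sum_pos[OF E, of u n]
        by (auto simp: log_ext_def)
      then show "ereal (ln (?z n) / real n) = log_ext (partition_sum E u n) / ereal (real n)"
        using n by simp
    qed
  qed
  then have "pressure E u = L" unfolding pressure_def by (rule limI)
  with L show ?thesis by simp
qed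

text \<open>
  Negative pressure is a negative exponential growth rate, so a convergent geometric series eventually dominates
  the partition sums.
\<close>

lemma partition_sum_summable:
  assumes E: "E \<noteq> {}" and fin: "partition_sum E u 1 \<noteq> \<infinity>" and neg: "pressure E u < 0"
  shows "summable (\<lambda>n. enn2real (partition_sum E u n))"
proof -
  let ?z = "\<lambda>n. enn2real (partition_sum E u n)"
  obtain c where c: "pressure E u < ereal c" "ereal c < 0"
    using ereal_dense2[OF neg] by blast
  have "\<forall>\<^sub>F n in sequentially. ereal (ln (?z n) / real n) < ereal c"
    using pressure_tendsto[OF E fin] c(1) by (rule order_tendstoD(2))
  then have "\<forall>\<^sub>F n in sequentially. norm (?z n) \<le> exp c ^ n"
    using eventually_ge_at_top[of 1]
  proof eventually_elim
    case (elim n)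
    have "0 < ?z n"
      using partition_sum_finite[OF fin, of n] partition_sum_pos[OF E, of u n]
      by (auto simp: enn2real_positive_iff less_top)
    moreover have "ln (?z n) \<le> real n * c" using elim by (simp add: field_simps)
    ultimately have "?z n \<le> exp (real n * c)" by (metis exp_le_cancel_iff exp_ln)
    then show ?case by (simp add: exp_of_nat_mult)
  qed
  moreover have "summable (\<lambda>n. exp c ^ n)" using c(2) by (intro summable_geometric) auto
  ultimately show ?thesis by (rule summable_comparison_test_ev)
qed

text \<open>
  Fix a sequence \<open>x\<close>. By finite irreducibility each letter \<open>i\<close> can be followed by one of finitely many
  connecting words and then by \<open>x\<close>. Along these sequences the Birkhoff sum of \<open>u\<close> differs from its first term by one of
  finitely many numbers, hence by a bounded amount, even when \<open>u\<close> itself is unbounded. So each term of the first partition sum is at most a constant times a term of the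
  later one, with different letters giving different words.
\<close>

lemma partition_sum_infinite:
  assumes irr: "finitely_irreducible I A" and var: "\<And>x y. x \<in> E \<Longrightarrow> y \<in> E \<Longrightarrow> x 0 = y 0 \<Longrightarrow> \<bar>u x - u y\<bar> \<le> V"
    and E: "E \<noteq> {}" and inf: "partition_sum E u 1 = \<infinity>"
  shows "partition_sum E u (Suc n) = \<infinity>"
proof -
  obtain \<Lambda> where \<Lambda>: "finite \<Lambda>"
    "\<And>i j. i \<in> I \<Longrightarrow> j \<in> I \<Longrightarrow> \<exists>\<omega>\<in>\<Lambda>. i # \<omega> @ [j] \<in> all_words (code_space I A)"
    using irr unfolding finitely_irreducible_def by blast
  obtain x where x: "x \<in> E" using E by blast
  have x0: "x 0 \<in> I" using x by (simp add: mem_E_iff)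
  obtain \<omega> where \<omega>: "\<And>i. i \<in> I \<Longrightarrow> \<omega> i \<in> \<Lambda>" "\<And>i. i \<in> I \<Longrightarrow> i # \<omega> i @ [x 0] \<in> all_words E"
    using \<Lambda>(2)[OF _ x0] unfolding E_def by metis
  define y where "y i = glue (i # \<omega> i) x" for i
  have y0: "y i 0 = i" for i by (simp add: y_def glue_def)
  have y: "y i \<in> E" if i: "i \<in> I" for i
  proof -
    define w where "w = i # \<omega> i"
    have "w @ [x 0] \<in> all_words E" using \<omega>(2)[OF i] by (simp add: w_def)
    then obtain m where "w @ [x 0] \<in> words E m" unfolding all_words_def by blast
    then obtain \<tau> where \<tau>: "\<tau> \<in> E" "w @ [x 0] = initial_word m \<tau>"
      unfolding words_eq by blast
    have m: "m = Suc (length w)" using arg_cong[OF \<tau>(2), of length] by simp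
    have nth: "(w @ [x 0]) ! i = \<tau> i" if "i \<le> length w" for i
      unfolding \<tau>(2) using that m by simp
    have "glue w x \<in> E"
    proof (rule glue_mem[OF x])
      fix i assume i: "i < length w"
      have wi: "w ! i = \<tau> i" using nth[of i] i by (simp add: nth_append)
      then show "w ! i \<in> I" using \<tau>(1) by (simp add: mem_E_iff)
      show "A (w ! i) ((w @ [x 0]) ! Suc i) = 1"
        using nth[of "Suc i"] i \<tau>(1) unfolding wi mem_E_iff by simp
    qed
    then show ?thesis by (simp add: y_def w_def)
  qed
  \<comment> \<open>finiteness of \<open>\<Lambda>\<close> makes this one constant for all letters\<close>
  define C where "C = (\<Sum>v\<in>\<Lambda>. \<bar>birkhoff_sum n u (glue v x)\<bar>)"
  have lower: "u (y i) - C \<le> birkhoff_sum (Suc n) u (y i)" if "i \<in> I" for i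
  proof -
    have "shift (y i) = glue (\<omega> i) x" by (auto simp: y_def glue_def shift_def fun_eq_iff)
    then have "birkhoff_sum (Suc n) u (y i) = u (y i) + birkhoff_sum n u (glue (\<omega> i) x)"
      using birkhoff_sum_add[of 1 n u "y i"] by (simp add: birkhoff_sum_def)
    moreover have "\<bar>birkhoff_sum n u (glue (\<omega> i) x)\<bar> \<le> C"
      unfolding C_def by (rule member_le_sum[of "\<omega> i" \<Lambda> "\<lambda>v. \<bar>birkhoff_sum n u (glue v x)\<bar>"]) 
        (use \<Lambda>(1) \<omega>(1)[OF that] in auto)
    ultimately show ?thesis by linarith
  qed
  define \<phi> where "\<phi> w = initial_word (Suc n) (y (hd w))" for w
  have w1: "\<exists>i\<in>I. w = [i]" if "w \<in> words E 1" for w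
    using that by (auto simp: words_eq initial_word_def mem_E_iff)
  have "partition_sum E u 1 \<le> ennreal (exp (V + C)) * partition_sum E u (Suc n)"
    unfolding partition_sum_eq
  proof (rule infsum_le_of_inj_on[where \<phi> = \<phi>])
    show "inj_on \<phi> (words E 1)"
    proof (rule inj_onI)
      fix v w assume "v \<in> words E 1" "w \<in> words E 1" "\<phi> v = \<phi> w"
      moreover have "hd (\<phi> w) = hd w" for w by (simp add: \<phi>_def initial_word_def hd_map y0 del: upt_Suc)
      ultimately show "v = w" using w1[of v] w1[of w] by (metis list.sel(1))
    qed
    show "\<phi> ` words E 1 \<subseteq> words E (Suc n)"
      using w1 y by (fastforce simp: \<phi>_def words_eq[of "Suc n"])
    fix w assume "w \<in> words E 1"
    then obtain i where i: "i \<in> I" "w = [i]" using w1 by blast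
    show "word_weight E u 1 w \<le> ennreal (exp (V + C)) * word_weight E u (Suc n) (\<phi> w)"
      unfolding word_weight_def[of E u 1]
    proof (rule SUP_least)
      fix \<tau> assume "\<tau> \<in> cylinder E w"
      then have \<tau>: "\<tau> \<in> E" "\<tau> 0 = y i 0" using i by (auto simp: cylinder_def y0)
      have "u \<tau> \<le> V + C + birkhoff_sum (Suc n) u (y i)"
        using var[OF \<tau>(1) y[OF i(1)] \<tau>(2)] lower[OF i(1)] by linarith
      then have "ennreal (exp (birkhoff_sum 1 u \<tau>)) \<le> ennreal (exp (V + C) * exp (birkhoff_sum (Suc n) u (y i)))"
        by (intro ennreal_leI) (simp add: birkhoff_sum_def flip: exp_add)
      also have "\<dots> \<le> ennreal (exp (V + C)) * word_weight E u (Suc n) (\<phi> w)"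
        unfolding \<phi>_def i(2) list.sel ennreal_mult'[OF exp_ge_zero]
        by (intro mult_left_mono exp_birkhoff_le_word_weight y i) auto
      finally show "ennreal (exp (birkhoff_sum 1 u \<tau>)) \<le> ennreal (exp (V + C)) * word_weight E u (Suc n) (\<phi> w)" .
    qed
  qed
  then show ?thesis using inf by (auto simp: top_unique ennreal_mult_eq_top_iff)
qed

text \<open>
  If the space is empty, all partition sums vanish; if the first partition sum is infinite, so are all later
  ones. In both cases the pressure is infinite.
\<close>

lemma pressure_zero_imp_finite:
  assumes irr: "finitely_irreducible I A" and var: "\<And>x y. x \<in> E \<Longrightarrow> y \<in> E \<Longrightarrow> x 0 = y 0 \<Longrightarrow> \<bar>u x - u y\<bar> \<le> V"
    and zero: "pressure E u = 0"
  shows "E \<noteq> {}" "partition_sum E u 1 \<noteq> \<infinity>"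
proof -
  have const: False
    if "\<And>n. n \<ge> 1 \<Longrightarrow> log_ext (partition_sum E u n) / ereal (real n) = c" "c \<noteq> 0" for c
  proof -
    have "(\<lambda>n. log_ext (partition_sum E u n) / ereal (real n)) \<longlonglongrightarrow> c"
      by (rule tendsto_eventually, rule eventually_sequentiallyI[of 1]) (use that in auto)
    then show False using that(2) zero by (simp add: pressure_def limI)
  qed
  show E: "E \<noteq> {}"
  proof
    assume "E = {}"
    then have "words E n = {}" for n using words_eq[of n] by simp
    then have "partition_sum E u n = 0" for n by (simp add: partition_sum_eq)
    then show False by (intro const[of "-\<infinity>"]) (auto simp: log_ext_def)
  qed
  show "partition_sum E u 1 \<noteq> \<infinity>"
  proof
    assume inf: "partition_sum E u 1 = \<infinity>"
    have "partition_sum E u (Suc n) = \<infinity>" for n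
      using irr var E inf by (rule partition_sum_infinite)
    then have "partition_sum E u n = \<infinity>" if "n \<ge> 1" for n
      using that by (metis Suc_pred' Suc_le_eq One_nat_def)
    then show False by (intro const[of \<infinity>]) (auto simp: log_ext_def)
  qed
qed

end

section \<open>Bounded Hoelder functions and operators on them\<close>

text \<open>
  The least such \<open>c\<close> is the larger of the supremum norm and the Hoelder seminorm, which is a norm equivalent to
  their sum: the lemmas \<open>holder_bound_norm\<close> and \<open>holder_norm_le\<close> below compare the two up to a factor \<open>2\<close>.
  With a single constant for values and variations, estimates need no separate treatment of the two parts
  of the norm and no extended reals.
\<close>

definition holder_bound ::
    "(nat \<Rightarrow> nat) set \<Rightarrow> real \<Rightarrow> real \<Rightarrow> ((nat \<Rightarrow> nat) \<Rightarrow> 'a::real_normed_vector) \<Rightarrow> bool" where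
  "holder_bound E \<theta> c f \<longleftrightarrow>
    (\<forall>x\<in>E. norm (f x) \<le> c) \<and>
    (\<forall>n\<ge>1. \<forall>x\<in>E. \<forall>y\<in>E. (\<forall>i<n. x i = y i) \<longrightarrow> norm (f x - f y) \<le> c * \<theta> ^ n)"

text \<open>
  Here \<open>C\<close> bounds the operator norm that belongs to \<^const>\<open>holder_bound\<close>. Sums and compositions of operators
  act on these constants in the expected way; the factor \<open>2\<close> of the norm comparison is paid once, when an
  estimate is transferred to \<^const>\<open>operator_norm\<close>.
\<close>

definition bounded_op :: "(nat \<Rightarrow> nat) set \<Rightarrow> real \<Rightarrow> real \<Rightarrow> operator \<Rightarrow> bool" where
  "bounded_op E \<theta> C T \<longleftrightarrow> 0 \<le> C \<and>
    (\<forall>g\<in>Holder_bdd E \<theta>. T g \<in> Holder_bdd E \<theta>) \<and>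
    (\<forall>g\<in>Holder_bdd E \<theta>. \<forall>h\<in>Holder_bdd E \<theta>. T (\<lambda>x. g x + h x) = (\<lambda>x. T g x + T h x)) \<and>
    (\<forall>c. \<forall>g\<in>Holder_bdd E \<theta>. T (\<lambda>x. c * g x) = (\<lambda>x. c * T g x)) \<and>
    (\<forall>c. \<forall>g\<in>Holder_bdd E \<theta>. holder_bound E \<theta> c g \<longrightarrow> holder_bound E \<theta> (C * c) (T g))"

lemma holder_boundD:
  assumes "holder_bound E \<theta> c f"
  shows "x \<in> E \<Longrightarrow> norm (f x) \<le> c"
    and "n \<ge> 1 \<Longrightarrow> x \<in> E \<Longrightarrow> y \<in> E \<Longrightarrow> (\<And>i. i < n \<Longrightarrow> x i = y i) \<Longrightarrow> norm (f x - f y) \<le> c * \<theta> ^ n"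
  using assms unfolding holder_bound_def by blast+

lemma holder_boundI:
  assumes "\<And>x. x \<in> E \<Longrightarrow> norm (f x) \<le> c"
    and "\<And>n x y. n \<ge> 1 \<Longrightarrow> x \<in> E \<Longrightarrow> y \<in> E \<Longrightarrow> (\<And>i. i < n \<Longrightarrow> x i = y i) \<Longrightarrow> norm (f x - f y) \<le> c * \<theta> ^ n"
  shows "holder_bound E \<theta> c f"
  using assms unfolding holder_bound_def by blast

lemma open_initial_segment: "open {y :: nat \<Rightarrow> nat. \<forall>i<n. y i = x i}"
proof -
  have "{y. \<forall>i<n. y i = x i} = (\<Inter>i\<in>{..<n}. (\<lambda>y. y i) -` {x i})" by auto
  moreover have "open ((\<lambda>y :: nat \<Rightarrow> nat. y i) -` {x i})" for i
    by (rule open_vimage[OF open_discrete]) simp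
  ultimately show ?thesis by (simp only:) (intro open_INT, auto)
qed

locale holder_space =
  fixes E :: "(nat \<Rightarrow> nat) set" and \<theta> :: real
  assumes theta: "0 < \<theta>" "\<theta> < 1"
begin

abbreviation "H \<equiv> Holder_bdd E \<theta>"

lemma seminorm_bound:
  fixes f :: "(nat \<Rightarrow> nat) \<Rightarrow> 'a::real_normed_vector"
  assumes fin: "holder_seminorm E \<theta> f < \<infinity>" and n: "n \<ge> 1"
    and xy: "x \<in> E" "y \<in> E" "\<And>i. i < n \<Longrightarrow> x i = y i"
  shows "norm (f x - f y) \<le> enn2real (holder_seminorm E \<theta> f) * \<theta> ^ n"
proof -
  have "ennreal (norm (f x - f y) / \<theta> ^ n) = ennreal (norm (f x - f y)) / ennreal (\<theta> ^ n)"
    using theta by (simp add: divide_ennreal)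
  also have "\<dots> \<le> variation E n f / ennreal (\<theta> ^ n)"
  proof (rule divide_right_mono_ennreal)
    have "ennreal (norm (f (fst (x, y)) - f (snd (x, y)))) \<le> variation E n f"
      unfolding variation_def case_prod_beta by (rule SUP_upper) (use xy in auto)
    then show "ennreal (norm (f x - f y)) \<le> variation E n f" by simp
  qed
  also have "\<dots> \<le> holder_seminorm E \<theta> f"
    unfolding holder_seminorm_def by (rule SUP_upper) (use n in auto)
  also have "\<dots> = ennreal (enn2real (holder_seminorm E \<theta> f))" using fin by simp
  finally have "norm (f x - f y) / \<theta> ^ n \<le> enn2real (holder_seminorm E \<theta> f)" by simp
  then show ?thesis using theta by (simp add: field_simps)
qed

lemma seminorm_le:
  fixes f :: "(nat \<Rightarrow> nat) \<Rightarrow> 'a::real_normed_vector"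
  assumes c: "0 \<le> c" and f: "\<And>n x y. n \<ge> 1 \<Longrightarrow> x \<in> E \<Longrightarrow> y \<in> E \<Longrightarrow> (\<And>i. i < n \<Longrightarrow> x i = y i)
    \<Longrightarrow> norm (f x - f y) \<le> c * \<theta> ^ n"
  shows "holder_seminorm E \<theta> f \<le> ennreal c"
  unfolding holder_seminorm_def
proof (rule SUP_least)
  fix n :: nat assume n: "n \<in> {1..}"
  have "variation E n f \<le> ennreal (c * \<theta> ^ n)"
    unfolding variation_def by (rule SUP_least) (use f n in \<open>auto intro!: ennreal_leI\<close>)
  then have "variation E n f / ennreal (\<theta> ^ n) \<le> ennreal (c * \<theta> ^ n) / ennreal (\<theta> ^ n)"
    by (rule divide_right_mono_ennreal)
  also have "\<dots> = ennreal c" using theta c by (simp add: divide_ennreal)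
  finally show "variation E n f / ennreal (\<theta> ^ n) \<le> ennreal c" .
qed

lemma Holder_realE:
  assumes "f \<in> Holder_real E \<theta>"
  obtains V where "0 \<le> V"
    "\<And>n x y. n \<ge> 1 \<Longrightarrow> x \<in> E \<Longrightarrow> y \<in> E \<Longrightarrow> (\<And>i. i < n \<Longrightarrow> x i = y i) \<Longrightarrow> \<bar>f x - f y\<bar> \<le> V * \<theta> ^ n"
proof (rule that)
  show "0 \<le> enn2real (holder_seminorm E \<theta> f)" by simp
  show "\<bar>f x - f y\<bar> \<le> enn2real (holder_seminorm E \<theta> f) * \<theta> ^ n"
    if "n \<ge> 1" "x \<in> E" "y \<in> E" "\<And>i. i < n \<Longrightarrow> x i = y i" for n x y
    using seminorm_bound[of f n x y] that assms by (simp add: Holder_real_def)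
qed

text \<open>
  Continuity follows from the decay of the variations, because the sequences that share the first \<open>n\<close> letters
  with a given one form an open set.
\<close>

lemma Holder_bddI:
  assumes zero: "\<And>x. x \<notin> E \<Longrightarrow> f x = 0" and f: "holder_bound E \<theta> c f"
  shows "f \<in> H"
  unfolding Holder_bdd_def mem_Collect_eq
proof (intro conjI allI impI)
  have f': "holder_bound E \<theta> \<bar>c\<bar> f"
    by (intro holder_boundI order.trans[OF holder_boundD(1)[OF f]] order.trans[OF holder_boundD(2)[OF f]])
      (use theta in \<open>auto intro!: mult_right_mono\<close>)
  show "continuous_on E f"
    unfolding continuous_on_def
  proof (intro ballI tendstoI)
    fix x and e :: real assume x: "x \<in> E" and e: "0 < e"
    have "(\<lambda>n. \<bar>c\<bar> * \<theta> ^ n) \<longlonglongrightarrow> \<bar>c\<bar> * 0"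
      by (intro tendsto_intros LIMSEQ_power_zero) (use theta in auto)
    then have "\<forall>\<^sub>F n in sequentially. \<bar>c\<bar> * \<theta> ^ n < e" using e by (auto dest: order_tendstoD)
    then obtain n where n: "\<bar>c\<bar> * \<theta> ^ n < e" "n \<ge> 1"
      by (metis (mono_tags, lifting) eventually_ge_at_top eventually_conj eventually_happens
          trivial_limit_sequentially)
    show "\<forall>\<^sub>F y in at x within E. dist (f y) (f x) < e"
      unfolding eventually_at_topological
    proof (intro exI conjI ballI impI)
      show "open {y. \<forall>i<n. y i = x i}" by (rule open_initial_segment)
      fix y assume "y \<in> {y. \<forall>i<n. y i = x i}" "y \<in> E"
      then have "norm (f y - f x) \<le> \<bar>c\<bar> * \<theta> ^ n" using x n by (intro holder_boundD(2)[OF f']) auto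
      then show "dist (f y) (f x) < e" using n by (simp add: dist_norm)
    qed auto
  qed
  show "holder_seminorm E \<theta> f < \<infinity>"
    using seminorm_le[of "\<bar>c\<bar>" f] holder_boundD(2)[OF f'] by (auto simp: less_top[symmetric] top_unique)
  have "supnorm E f \<le> ennreal \<bar>c\<bar>"
    unfolding supnorm_def by (rule SUP_least) (use holder_boundD(1)[OF f'] in \<open>auto intro!: ennreal_leI\<close>)
  then show "supnorm E f < \<infinity>" by (auto simp: less_top[symmetric] top_unique)
qed (use zero in auto)

lemma Holder_bdd_zero: "g \<in> H \<Longrightarrow> x \<notin> E \<Longrightarrow> g x = 0"
  by (simp add: Holder_bdd_def)

lemma holder_bound_norm:
  assumes "g \<in> H"
  shows "holder_bound E \<theta> (holder_norm E \<theta> g) g"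
proof -
  have fin: "holder_seminorm E \<theta> g < \<infinity>" "supnorm E g < \<infinity>" using assms by (auto simp: Holder_bdd_def)
  have eq: "holder_norm E \<theta> g = enn2real (holder_seminorm E \<theta> g) + enn2real (supnorm E g)"
    using fin by (simp add: holder_norm_def enn2real_plus)
  show ?thesis
  proof (rule holder_boundI)
    fix x assume "x \<in> E"
    then have "ennreal (norm (g x)) \<le> supnorm E g" unfolding supnorm_def by (rule SUP_upper)
    also have "\<dots> = ennreal (enn2real (supnorm E g))" using fin by simp
    finally have "norm (g x) \<le> enn2real (supnorm E g)" by simp
    moreover have "0 \<le> enn2real (holder_seminorm E \<theta> g)" by simp
    ultimately show "norm (g x) \<le> holder_norm E \<theta> g" unfolding eq by linarith
  next
    fix n x y assume "(n::nat) \<ge> 1" "x \<in> E" "y \<in> E" "\<And>i. i < n \<Longrightarrow> x i = y i"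
    then have "norm (g x - g y) \<le> enn2real (holder_seminorm E \<theta> g) * \<theta> ^ n"
      by (rule seminorm_bound[OF fin(1)])
    also have "\<dots> \<le> holder_norm E \<theta> g * \<theta> ^ n"
      unfolding eq using theta by (intro mult_right_mono) auto
    finally show "norm (g x - g y) \<le> holder_norm E \<theta> g * \<theta> ^ n" .
  qed
qed

lemma holder_norm_le:
  assumes c: "0 \<le> c" and g: "holder_bound E \<theta> c g"
  shows "holder_norm E \<theta> g \<le> 2 * c"
proof -
  have "holder_seminorm E \<theta> g + supnorm E g \<le> ennreal c + ennreal c"
    unfolding supnorm_def
    by (intro add_mono seminorm_le c SUP_least ennreal_leI holder_boundD[OF g])
  also have "\<dots> = ennreal (2 * c)" using c by (simp flip: ennreal_plus)
  finally have "enn2real (holder_seminorm E \<theta> g + supnorm E g) \<le> enn2real (ennreal (2 * c))"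
    by (rule enn2real_mono) simp
  then show ?thesis using c by (simp add: holder_norm_def)
qed

lemma holder_norm_nonneg: "0 \<le> holder_norm E \<theta> g"
  by (simp add: holder_norm_def)

lemma Holder_bddE:
  assumes "g \<in> H"
  obtains c where "0 \<le> c" "holder_bound E \<theta> c g"
  using holder_bound_norm[OF assms] holder_norm_nonneg by blast

lemma holder_bound_add:
  assumes "holder_bound E \<theta> c f" "holder_bound E \<theta> d g"
  shows "holder_bound E \<theta> (c + d) (\<lambda>x. f x + g x)"
proof (rule holder_boundI)
  show "norm (f x + g x) \<le> c + d" if "x \<in> E" for x
    by (intro norm_triangle_mono holder_boundD(1)[OF assms(1)] holder_boundD(1)[OF assms(2)] that)
  show "norm (f x + g x - (f y + g y)) \<le> (c + d) * \<theta> ^ n"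
    if "n \<ge> 1" "x \<in> E" "y \<in> E" "\<And>i. i < n \<Longrightarrow> x i = y i" for n x y
    unfolding add_diff_add distrib_right
    by (intro norm_triangle_mono holder_boundD(2)[OF assms(1)] holder_boundD(2)[OF assms(2)] that)
qed

lemma holder_bound_scale:
  fixes f :: "(nat \<Rightarrow> nat) \<Rightarrow> complex"
  assumes "holder_bound E \<theta> c f"
  shows "holder_bound E \<theta> (norm a * c) (\<lambda>x. a * f x)"
proof (rule holder_boundI)
  show "norm (a * f x) \<le> norm a * c" if "x \<in> E" for x
    unfolding norm_mult by (intro mult_left_mono holder_boundD(1)[OF assms] that norm_ge_zero)
  show "norm (a * f x - a * f y) \<le> norm a * c * \<theta> ^ n"
    if "n \<ge> 1" "x \<in> E" "y \<in> E" "\<And>i. i < n \<Longrightarrow> x i = y i" for n x y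
    unfolding right_diff_distrib[symmetric] norm_mult mult.assoc
    by (intro mult_left_mono holder_boundD(2)[OF assms] that norm_ge_zero)
qed

lemma Holder_bdd_add: "f \<in> H \<Longrightarrow> g \<in> H \<Longrightarrow> (\<lambda>x. f x + g x) \<in> H"
  using Holder_bddI[OF _ holder_bound_add[OF holder_bound_norm holder_bound_norm]]
  by (simp add: Holder_bdd_zero)

lemma Holder_bdd_scale: "f \<in> H \<Longrightarrow> (\<lambda>x. a * f x) \<in> H"
  using Holder_bddI[OF _ holder_bound_scale[OF holder_bound_norm]] by (simp add: Holder_bdd_zero)

lemma Holder_bdd_diff: "f \<in> H \<Longrightarrow> g \<in> H \<Longrightarrow> (\<lambda>x. f x - g x) \<in> H"
  using Holder_bdd_add[OF _ Holder_bdd_scale[of g "-1"], of f] by simp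

lemma Holder_bdd_0: "(\<lambda>x. 0) \<in> H"
  by (rule Holder_bddI[where c = 0]) (auto intro: holder_boundI)

lemma Holder_bdd_sum: "(\<And>n. f n \<in> H) \<Longrightarrow> (\<lambda>x. \<Sum>n<(N::nat). f n x) \<in> H"
  by (induction N) (auto simp: Holder_bdd_0 intro: Holder_bdd_add)

text \<open>
  Completeness of the space in the form in which the Neumann series uses it: the limit is formed pointwise and
  inherits the bounds of the partial sums.
\<close>

lemma holder_series:
  assumes mem: "\<And>n. f n \<in> H" and bound: "\<And>n. holder_bound E \<theta> (D n) (f n)" and D: "summable D"
  shows "summable (\<lambda>n. f n x)" "(\<lambda>x. \<Sum>n. f n x) \<in> H" "holder_bound E \<theta> (suminf D) (\<lambda>x. \<Sum>n. f n x)"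
proof -
  show sm: "summable (\<lambda>n. f n x)" for x
  proof (cases "x \<in> E")
    case True
    then have "norm (f n x) \<le> D n" for n by (rule holder_boundD(1)[OF bound])
    with D show ?thesis by (rule summable_comparison_test')
  qed (simp add: Holder_bdd_zero[OF mem])
  show hb: "holder_bound E \<theta> (suminf D) (\<lambda>x. \<Sum>n. f n x)"
  proof (rule holder_boundI)
    show "norm (\<Sum>n. f n x) \<le> suminf D" if "x \<in> E" for x
      by (rule norm_suminf_le[OF holder_boundD(1)[OF bound that] D])
    fix n x y assume xy: "(n::nat) \<ge> 1" "x \<in> E" "y \<in> E" "\<And>i. i < n \<Longrightarrow> x i = y i"
    have "(\<Sum>m. f m x) - (\<Sum>m. f m y) = (\<Sum>m. f m x - f m y)" by (rule suminf_diff[OF sm sm])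
    also have "norm \<dots> \<le> (\<Sum>m. D m * \<theta> ^ n)"
      by (rule norm_suminf_le[OF holder_boundD(2)[OF bound xy] summable_mult2[OF D]])
    also have "\<dots> = suminf D * \<theta> ^ n" by (rule suminf_mult2[OF D, symmetric])
    finally show "norm ((\<Sum>m. f m x) - (\<Sum>m. f m y)) \<le> suminf D * \<theta> ^ n" .
  qed
  show "(\<lambda>x. \<Sum>n. f n x) \<in> H"
    by (rule Holder_bddI[OF _ hb]) (simp add: Holder_bdd_zero[OF mem])
qed

lemma bounded_opD:
  assumes "bounded_op E \<theta> C T"
  shows "0 \<le> C" "g \<in> H \<Longrightarrow> T g \<in> H"
    "g \<in> H \<Longrightarrow> h \<in> H \<Longrightarrow> T (\<lambda>x. g x + h x) = (\<lambda>x. T g x + T h x)"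
    "g \<in> H \<Longrightarrow> T (\<lambda>x. a * g x) = (\<lambda>x. a * T g x)"
    "g \<in> H \<Longrightarrow> holder_bound E \<theta> c g \<Longrightarrow> holder_bound E \<theta> (C * c) (T g)"
  using assms unfolding bounded_op_def by blast+

lemma bounded_op_diff_arg:
  assumes "bounded_op E \<theta> C T" "g \<in> H" "h \<in> H"
  shows "T (\<lambda>x. g x - h x) = (\<lambda>x. T g x - T h x)"
proof -
  have "T (\<lambda>x. g x + (- 1) * h x) = (\<lambda>x. T g x + (- 1) * T h x)"
    by (simp only: bounded_opD(3)[OF assms(1,2) Holder_bdd_scale[OF assms(3)]]
        bounded_opD(4)[OF assms(1,3)])
  then show ?thesis by simp
qed

lemma bounded_op_sum_arg:
  assumes T: "bounded_op E \<theta> C T" and f: "\<And>n. f n \<in> H"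
  shows "T (\<lambda>x. \<Sum>n<(N::nat). f n x) = (\<lambda>x. \<Sum>n<N. T (f n) x)"
proof (induction N)
  case 0
  have "T (\<lambda>x. 0 * 0) = (\<lambda>x. 0 * T (\<lambda>x. 0) x)" by (rule bounded_opD(4)[OF T Holder_bdd_0])
  then show ?case by simp
next
  case (Suc N)
  have "T (\<lambda>x. (\<Sum>n<N. f n x) + f N x) = (\<lambda>x. T (\<lambda>x. \<Sum>n<N. f n x) x + T (f N) x)"
    by (rule bounded_opD(3)[OF T Holder_bdd_sum[OF f] f])
  then show ?case unfolding Suc.IH sum.lessThan_Suc .
qed

lemma bounded_op_cong:
  assumes T: "bounded_op E \<theta> C T" and eq: "\<And>g. g \<in> H \<Longrightarrow> T' g = T g"
  shows "bounded_op E \<theta> C T'"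
  using T unfolding bounded_op_def
  by (simp add: eq Holder_bdd_add Holder_bdd_scale)

lemma bounded_op_mono:
  assumes T: "bounded_op E \<theta> C T" and le: "C \<le> C'"
  shows "bounded_op E \<theta> C' T"
proof -
  have "holder_bound E \<theta> (C' * c) (T g)" if g: "g \<in> H" "holder_bound E \<theta> c g" for g c
  proof (rule holder_boundI)
    note b = bounded_opD(5)[OF T g]
    have c: "C * c \<le> C' * c" if "x \<in> E" for x
      using holder_boundD(1)[OF g(2) that] norm_ge_zero[of "g x"] le by (intro mult_right_mono) linarith+
    show "norm (T g x) \<le> C' * c" if "x \<in> E" for x
      using holder_boundD(1)[OF b that] c[OF that] by linarith
    show "norm (T g x - T g y) \<le> C' * c * \<theta> ^ n"
      if "n \<ge> 1" "x \<in> E" "y \<in> E" "\<And>i. i < n \<Longrightarrow> x i = y i" for n x y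
      using holder_boundD(2)[OF b that] mult_right_mono[OF c[OF that(2)], of "\<theta> ^ n"] theta by force
  qed
  moreover have "0 \<le> C'" using bounded_opD(1)[OF T] le by linarith
  ultimately show ?thesis using T unfolding bounded_op_def by blast
qed

lemma bounded_op_id: "bounded_op E \<theta> 1 (\<lambda>g. g)"
  by (simp add: bounded_op_def)

lemma bounded_op_add:
  assumes S: "bounded_op E \<theta> C S" and T: "bounded_op E \<theta> D T"
  shows "bounded_op E \<theta> (C + D) (\<lambda>g x. S g x + T g x)"
  unfolding bounded_op_def
proof (intro conjI ballI allI impI)
  show "0 \<le> C + D" using bounded_opD(1)[OF S] bounded_opD(1)[OF T] by simp
  show "(\<lambda>x. S g x + T g x) \<in> H" if "g \<in> H" for g
    by (intro Holder_bdd_add bounded_opD(2)[OF S] bounded_opD(2)[OF T] that)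
  show "(\<lambda>x. S (\<lambda>x. g x + h x) x + T (\<lambda>x. g x + h x) x) = (\<lambda>x. S g x + T g x + (S h x + T h x))"
    if "g \<in> H" "h \<in> H" for g h
    unfolding bounded_opD(3)[OF S that] bounded_opD(3)[OF T that] by (simp add: algebra_simps)
  show "(\<lambda>x. S (\<lambda>x. c * g x) x + T (\<lambda>x. c * g x) x) = (\<lambda>x. c * (S g x + T g x))"
    if "g \<in> H" for g c
    unfolding bounded_opD(4)[OF S that] bounded_opD(4)[OF T that] by (simp add: algebra_simps)
  show "holder_bound E \<theta> ((C + D) * c) (\<lambda>x. S g x + T g x)" if "g \<in> H" "holder_bound E \<theta> c g" for g c
    unfolding distrib_right
    by (intro holder_bound_add bounded_opD(5)[OF S] bounded_opD(5)[OF T] that)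
qed

lemma bounded_op_scale:
  fixes a :: complex
  assumes T: "bounded_op E \<theta> C T"
  shows "bounded_op E \<theta> (norm a * C) (\<lambda>g x. a * T g x)"
  unfolding bounded_op_def
proof (intro conjI ballI allI impI)
  show "0 \<le> norm a * C" using bounded_opD(1)[OF T] by simp
  show "(\<lambda>x. a * T g x) \<in> H" if "g \<in> H" for g
    by (intro Holder_bdd_scale bounded_opD(2)[OF T] that)
  show "(\<lambda>x. a * T (\<lambda>x. g x + h x) x) = (\<lambda>x. a * T g x + a * T h x)" if "g \<in> H" "h \<in> H" for g h
    unfolding bounded_opD(3)[OF T that] by (simp add: algebra_simps)
  show "(\<lambda>x. a * T (\<lambda>x. c * g x) x) = (\<lambda>x. c * (a * T g x))" if "g \<in> H" for g c
    unfolding bounded_opD(4)[OF T that] by (simp add: algebra_simps)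
  show "holder_bound E \<theta> (norm a * C * c) (\<lambda>x. a * T g x)" if "g \<in> H" "holder_bound E \<theta> c g" for g c
    unfolding mult.assoc by (intro holder_bound_scale bounded_opD(5)[OF T] that)
qed

lemma bounded_op_diff:
  assumes S: "bounded_op E \<theta> C S" and T: "bounded_op E \<theta> D T"
  shows "bounded_op E \<theta> (C + D) (\<lambda>g x. S g x - T g x)"
  using bounded_op_add[OF S bounded_op_scale[OF T, of "-1"]] by simp

lemma bounded_op_comp:
  assumes S: "bounded_op E \<theta> C S" and T: "bounded_op E \<theta> D T"
  shows "bounded_op E \<theta> (C * D) (\<lambda>g. S (T g))"
  unfolding bounded_op_def
proof (intro conjI ballI allI impI)
  show "0 \<le> C * D" using bounded_opD(1)[OF S] bounded_opD(1)[OF T] by simp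
  show "S (T g) \<in> H" if "g \<in> H" for g
    by (intro bounded_opD(2)[OF S] bounded_opD(2)[OF T] that)
  show "S (T (\<lambda>x. g x + h x)) = (\<lambda>x. S (T g) x + S (T h) x)" if "g \<in> H" "h \<in> H" for g h
    unfolding bounded_opD(3)[OF T that]
    by (rule bounded_opD(3)[OF S bounded_opD(2)[OF T that(1)] bounded_opD(2)[OF T that(2)]])
  show "S (T (\<lambda>x. c * g x)) = (\<lambda>x. c * S (T g) x)" if "g \<in> H" for g c
    unfolding bounded_opD(4)[OF T that] by (rule bounded_opD(4)[OF S bounded_opD(2)[OF T that]])
  show "holder_bound E \<theta> (C * D * c) (S (T g))" if "g \<in> H" "holder_bound E \<theta> c g" for g c
    unfolding mult.assoc by (intro bounded_opD(5)[OF S] bounded_opD(2)[OF T] bounded_opD(5)[OF T] that)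
qed

lemma bounded_op_holder_norm_le:
  assumes T: "bounded_op E \<theta> C T" and g: "g \<in> H"
  shows "holder_norm E \<theta> (T g) \<le> 2 * C * holder_norm E \<theta> g"
  using holder_norm_le[OF _ bounded_opD(5)[OF T g holder_bound_norm[OF g]]]
    bounded_opD(1)[OF T] holder_norm_nonneg[of g] by simp

lemma bounded_op_mem_bdd_operators:
  assumes T: "bounded_op E \<theta> C T"
  shows "T \<in> bdd_operators E \<theta>"
  unfolding bdd_operators_def
  using T bounded_op_holder_norm_le[OF T] unfolding bounded_op_def by blast

lemma operator_norm_le:
  assumes T: "bounded_op E \<theta> C T"
  shows "\<bar>operator_norm E \<theta> T\<bar> \<le> 2 * C"
proof -
  let ?B = "{g \<in> H. holder_norm E \<theta> g \<le> 1}"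
  have z: "(\<lambda>x. 0) \<in> ?B"
  proof -
    have "holder_norm E \<theta> (\<lambda>x. 0) \<le> 2 * 0" by (rule holder_norm_le) (auto intro: holder_boundI)
    then show ?thesis by (simp add: Holder_bdd_0)
  qed
  have le: "holder_norm E \<theta> (T g) \<le> 2 * C" if "g \<in> ?B" for g
  proof -
    have "holder_norm E \<theta> (T g) \<le> 2 * C * holder_norm E \<theta> g"
      using that by (intro bounded_op_holder_norm_le[OF T]) auto
    also have "\<dots> \<le> 2 * C * 1" using that bounded_opD(1)[OF T] by (intro mult_left_mono) auto
    finally show ?thesis by simp
  qed
  have "operator_norm E \<theta> T \<le> 2 * C"
    unfolding operator_norm_def by (rule cSUP_least) (use z le in auto)
  moreover have "0 \<le> operator_norm E \<theta> T"
    unfolding operator_norm_def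
    by (rule order.trans[OF holder_norm_nonneg cSUP_upper[OF z]]) (rule bdd_aboveI2, rule le)
  ultimately show ?thesis by simp
qed

lemma operator_norm_cong:
  "(\<And>g. g \<in> H \<Longrightarrow> S g = T g) \<Longrightarrow> operator_norm E \<theta> S = operator_norm E \<theta> T"
  unfolding operator_norm_def by (rule SUP_cong) auto

section \<open>Neumann series and resolvents\<close>

text \<open>
  That \<open>R\<close> is a left inverse is a telescoping of pointwise series. For the right inverse \<open>L\<close> must be exchanged
  with the series: \<open>L\<close> maps the tail from index \<open>N\<close> on to a function bounded by \<open>B\<close> times a tail of \<open>\<Sum>n. C n\<close>,
  which tends to \<open>0\<close>.
\<close>

lemma neumann_series:
  assumes L: "bounded_op E \<theta> B L" and pow: "\<And>n. bounded_op E \<theta> (C n) (L ^^ n)" and C: "summable C"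
  defines "R \<equiv> (\<lambda>g x. \<Sum>n. (L ^^ n) g x)"
  shows "bounded_op E \<theta> (suminf C) R"
    and "g \<in> H \<Longrightarrow> R (\<lambda>x. g x - L g x) = g"
    and "g \<in> H \<Longrightarrow> (\<lambda>x. R g x - L (R g) x) = g"
proof -
  have series: "summable (\<lambda>n. (L ^^ n) g x)" "R g \<in> H" "holder_bound E \<theta> (suminf C * c) (R g)"
    if g: "g \<in> H" "holder_bound E \<theta> c g" for g c x
    using holder_series[of "\<lambda>n. (L ^^ n) g" "\<lambda>n. C n * c"] bounded_opD(2,5)[OF pow] g C
    unfolding R_def by (auto simp: summable_mult2 suminf_mult2[symmetric])
  have sm: "summable (\<lambda>n. (L ^^ n) g x)" and RH: "R g \<in> H" if "g \<in> H" for g x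
    using Holder_bddE[OF that] series(1,2)[OF that] by blast+
  show bR: "bounded_op E \<theta> (suminf C) R"
    unfolding bounded_op_def
  proof (intro conjI ballI allI impI)
    show "0 \<le> suminf C" using C bounded_opD(1)[OF pow] by (rule suminf_nonneg)
    show "R (\<lambda>x. g x + h x) = (\<lambda>x. R g x + R h x)" if "g \<in> H" "h \<in> H" for g h
      unfolding R_def by (simp add: bounded_opD(3)[OF pow that] suminf_add[OF sm sm, OF that])
    show "R (\<lambda>x. c * g x) = (\<lambda>x. c * R g x)" if "g \<in> H" for g c
      unfolding R_def by (simp add: bounded_opD(4)[OF pow that] suminf_mult[OF sm, OF that])
  qed (use RH series(3) in auto)
  have Rtail: "(\<Sum>n. (L ^^ Suc n) g x) = R g x - g x" if "g \<in> H" for g x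
    unfolding R_def using suminf_split_head[OF sm[OF that]] by simp
  show "R (\<lambda>x. g x - L g x) = g" if g: "g \<in> H"
  proof -
    have "R (L g) = (\<lambda>x. R g x - g x)"
      unfolding Rtail[OF g, symmetric] unfolding R_def by (simp add: funpow_swap1)
    then show ?thesis using bounded_op_diff_arg[OF bR g bounded_opD(2)[OF L g]] by simp
  qed
  show "(\<lambda>x. R g x - L (R g) x) = g" if g: "g \<in> H"
  proof
    fix x
    let ?S = "\<lambda>N x. \<Sum>n<N. (L ^^ n) g x"
    obtain c where c: "holder_bound E \<theta> c g" using Holder_bddE[OF g] by blast
    have powH: "(L ^^ n) g \<in> H" for n by (rule bounded_opD(2)[OF pow g])
    have "L (R g) x = (\<Sum>n. (L ^^ Suc n) g x)"
    proof (cases "x \<in> E")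
      case False
      then have "L f x = 0" if "f \<in> H" for f by (intro Holder_bdd_zero bounded_opD(2)[OF L] that)
      then show ?thesis using RH[OF g] powH by simp
    next
      case True
      have diff: "norm (L (R g) x - (\<Sum>n<N. (L ^^ Suc n) g x)) \<le> B * (\<Sum>n. C (n + N) * c)" for N
      proof -
        let ?T = "\<lambda>x. \<Sum>n. (L ^^ (n + N)) g x"
        have T: "?T \<in> H" "holder_bound E \<theta> (\<Sum>n. C (n + N) * c) ?T"
          using holder_series[of "\<lambda>n. (L ^^ (n + N)) g" "\<lambda>n. C (n + N) * c"]
            powH bounded_opD(5)[OF pow g c] summable_mult2[OF C, of c]
          by (auto simp: summable_iff_shift[of "\<lambda>n. C n * c"])
        have "?T = (\<lambda>x. R g x - ?S N x)"
          unfolding R_def by (rule ext, rule suminf_minus_initial_segment[OF sm[OF g]])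
        then have "L ?T = (\<lambda>x. L (R g) x - (\<Sum>n<N. (L ^^ Suc n) g x))"
          using bounded_op_diff_arg[OF L RH[OF g] Holder_bdd_sum[OF powH]] bounded_op_sum_arg[OF L powH]
          by simp
        then show ?thesis using holder_boundD(1)[OF bounded_opD(5)[OF L T] True] by metis
      qed
      have "(\<lambda>N. B * (\<Sum>n. C (n + N) * c)) \<longlonglongrightarrow> B * 0"
        by (intro tendsto_mult tendsto_const suminf_exist_split2 summable_mult2[OF C])
      then have "(\<lambda>N. L (R g) x - (\<Sum>n<N. (L ^^ Suc n) g x)) \<longlonglongrightarrow> 0"
        unfolding mult_zero_right by (rule Lim_null_comparison[OF always_eventually[OF allI[OF diff]]])
      then have "(\<lambda>N. L (R g) x - (L (R g) x - (\<Sum>n<N. (L ^^ Suc n) g x))) \<longlonglongrightarrow> L (R g) x - 0"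
        by (intro tendsto_diff tendsto_const)
      then have "(\<lambda>n. (L ^^ Suc n) g x) sums L (R g) x" by (simp add: sums_def)
      then show ?thesis by (rule sums_unique)
    qed
    then show "R g x - L (R g) x = g x" using Rtail[OF g] by simp
  qed
qed

lemma inverse_operator_eq:
  assumes R: "\<And>g. g \<in> H \<Longrightarrow> R g \<in> H" and left: "\<And>g. g \<in> H \<Longrightarrow> R (T g) = g"
    and right: "\<And>g. g \<in> H \<Longrightarrow> T (R g) = g" and g: "g \<in> H"
  shows "inverse_operator E \<theta> T g = R g"
  unfolding inverse_operator_def
proof (rule inv_into_f_eq)
  show "inj_on T H" by (rule inj_on_inverseI[of _ R]) (rule left)
qed (use R right g in auto)

text \<open>
  Put \<open>h = z - z\<^sub>0\<close>, \<open>\<Delta> = L\<^sub>z - L\<^sub>0\<close> and \<open>Q = \<Delta> - h L'\<close>. The resolvent identity \<open>R\<^sub>z - R\<^sub>0 = R\<^sub>z \<Delta> R\<^sub>0\<close>, used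
  twice, gives
  \<open>(R\<^sub>z - R\<^sub>0) / h - R\<^sub>0 L' R\<^sub>0 = h\<inverse> R\<^sub>z Q R\<^sub>0 + R\<^sub>z \<Delta> R\<^sub>0 L' R\<^sub>0\<close>,
  and both terms are of order \<open>\<bar>h\<bar>\<close> since \<open>Q\<close> is of order \<open>\<bar>h\<bar>\<^sup>2\<close> and \<open>\<Delta>\<close> of order \<open>\<bar>h\<bar>\<close>.
\<close>

lemma resolvent_derivative:
  fixes L R :: "complex \<Rightarrow> operator" and L' :: operator
  assumes r: "0 < r"
    and R: "\<And>z. norm (z - z\<^sub>0) \<le> r \<Longrightarrow> bounded_op E \<theta> S (R z)"
    and left: "\<And>z g. norm (z - z\<^sub>0) \<le> r \<Longrightarrow> g \<in> H \<Longrightarrow> R z (\<lambda>x. g x - L z g x) = g"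
    and right: "\<And>z g. norm (z - z\<^sub>0) \<le> r \<Longrightarrow> g \<in> H \<Longrightarrow> (\<lambda>x. R z g x - L z (R z g) x) = g"
    and L: "\<And>z. norm (z - z\<^sub>0) \<le> r \<Longrightarrow> bounded_op E \<theta> B (L z)"
    and L': "bounded_op E \<theta> D L'"
    and rem: "\<And>z. norm (z - z\<^sub>0) \<le> r \<Longrightarrow>
      bounded_op E \<theta> (K * norm (z - z\<^sub>0) ^ 2) (\<lambda>g x. L z g x - L z\<^sub>0 g x - (z - z\<^sub>0) * L' g x)"
  shows "((\<lambda>z. operator_norm E \<theta>
    (\<lambda>g x. (R z g x - R z\<^sub>0 g x) / (z - z\<^sub>0) - R z\<^sub>0 (L' (R z\<^sub>0 g)) x)) \<longlongrightarrow> 0) (at z\<^sub>0)"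
proof -
  define M where "M = S * K * S + S * (K * r + D) * S * D * S"
  have z0: "norm (z\<^sub>0 - z\<^sub>0) \<le> r" using r by simp
  have bound: "bounded_op E \<theta> (M * norm (z - z\<^sub>0))
      (\<lambda>g x. (R z g x - R z\<^sub>0 g x) / (z - z\<^sub>0) - R z\<^sub>0 (L' (R z\<^sub>0 g)) x)"
    if z: "norm (z - z\<^sub>0) \<le> r" and ne: "z \<noteq> z\<^sub>0" for z
  proof -
    define h where "h = z - z\<^sub>0"
    have h: "h \<noteq> 0" "norm h \<le> r" using ne z by (auto simp: h_def)
    define Q where "Q = (\<lambda>g x. L z g x - L z\<^sub>0 g x - h * L' g x)"
    define \<Delta> where "\<Delta> = (\<lambda>g x. Q g x + h * L' g x)"
    have Q: "bounded_op E \<theta> (K * norm h ^ 2) Q" unfolding Q_def h_def by (rule rem[OF z])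
    have \<Delta>: "bounded_op E \<theta> (K * norm h ^ 2 + norm h * D) \<Delta>"
      unfolding \<Delta>_def by (intro bounded_op_add Q bounded_op_scale L')
    note Rz = R[OF z] and R0 = R[OF z0]
    have resolvent: "(\<lambda>x. R z g x - R z\<^sub>0 g x) = R z (\<Delta> (R z\<^sub>0 g))" if g: "g \<in> H" for g
    proof -
      have R0g: "R z\<^sub>0 g \<in> H" by (rule bounded_opD(2)[OF R0 g])
      note L0R0g = bounded_opD(2)[OF L[OF z0] R0g] and LzR0g = bounded_opD(2)[OF L[OF z] R0g]
      have \<Delta>_eq: "\<Delta> (R z\<^sub>0 g) = (\<lambda>x. (R z\<^sub>0 g x - L z\<^sub>0 (R z\<^sub>0 g) x) - (R z\<^sub>0 g x - L z (R z\<^sub>0 g) x))"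
        by (simp add: \<Delta>_def Q_def fun_eq_iff)
      have "R z (\<lambda>x. (R z\<^sub>0 g x - L z\<^sub>0 (R z\<^sub>0 g) x) - (R z\<^sub>0 g x - L z (R z\<^sub>0 g) x))
          = (\<lambda>x. R z g x - R z\<^sub>0 g x)"
        using bounded_op_diff_arg[OF Rz Holder_bdd_diff[OF R0g L0R0g] Holder_bdd_diff[OF R0g LzR0g]]
        unfolding right[OF z0 g] left[OF z R0g] .
      then show ?thesis unfolding \<Delta>_eq by (rule sym)
    qed
    have "bounded_op E \<theta> (norm (1 / h) * (S * (K * norm h ^ 2 * S))
          + S * ((K * norm h ^ 2 + norm h * D) * (S * (D * S))))
        (\<lambda>g x. 1 / h * R z (Q (R z\<^sub>0 g)) x + R z (\<Delta> (R z\<^sub>0 (L' (R z\<^sub>0 g)))) x)"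
      by (rule bounded_op_add[OF bounded_op_scale[OF bounded_op_comp[OF Rz bounded_op_comp[OF Q R0]]]
            bounded_op_comp[OF Rz bounded_op_comp[OF \<Delta> bounded_op_comp[OF R0 bounded_op_comp[OF L' R0]]]]])
    also have "norm (1 / h) * (S * (K * norm h ^ 2 * S))
        + S * ((K * norm h ^ 2 + norm h * D) * (S * (D * S)))
        = (S * K * S + S * (K * norm h + D) * S * D * S) * norm h"
      using h by (simp add: norm_divide power2_eq_square field_simps)
    finally have "bounded_op E \<theta> ((S * K * S + S * (K * norm h + D) * S * D * S) * norm h)
        (\<lambda>g x. 1 / h * R z (Q (R z\<^sub>0 g)) x + R z (\<Delta> (R z\<^sub>0 (L' (R z\<^sub>0 g)))) x)" .
    moreover have "(S * K * S + S * (K * norm h + D) * S * D * S) * norm h \<le> M * norm h"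
    proof -
      have "0 \<le> K * norm h ^ 2" using bounded_opD(1)[OF Q] .
      then have K: "0 \<le> K" using h by (simp add: zero_le_mult_iff)
      show ?thesis
        unfolding M_def using h K bounded_opD(1)[OF Rz] bounded_opD(1)[OF L']
        by (intro mult_right_mono add_mono mult_left_mono) auto
    qed
    ultimately have "bounded_op E \<theta> (M * norm h)
        (\<lambda>g x. 1 / h * R z (Q (R z\<^sub>0 g)) x + R z (\<Delta> (R z\<^sub>0 (L' (R z\<^sub>0 g)))) x)"
      by (rule bounded_op_mono)
    then show ?thesis
      unfolding h_def[symmetric]
    proof (rule bounded_op_cong)
      fix g assume g: "g \<in> H"
      have R0g: "R z\<^sub>0 g \<in> H" by (rule bounded_opD(2)[OF R0 g])
      have L'R0g: "L' (R z\<^sub>0 g) \<in> H" by (rule bounded_opD(2)[OF L' R0g])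
      have "Q (R z\<^sub>0 g) = (\<lambda>x. \<Delta> (R z\<^sub>0 g) x - h * L' (R z\<^sub>0 g) x)"
        by (simp add: \<Delta>_def)
      then have "R z (Q (R z\<^sub>0 g)) = (\<lambda>x. R z (\<Delta> (R z\<^sub>0 g)) x - h * R z (L' (R z\<^sub>0 g)) x)"
        using bounded_op_diff_arg[OF Rz bounded_opD(2)[OF \<Delta> R0g] Holder_bdd_scale[OF L'R0g]]
          bounded_opD(4)[OF Rz L'R0g] by simp
      then show "(\<lambda>x. (R z g x - R z\<^sub>0 g x) / h - R z\<^sub>0 (L' (R z\<^sub>0 g)) x)
          = (\<lambda>x. 1 / h * R z (Q (R z\<^sub>0 g)) x + R z (\<Delta> (R z\<^sub>0 (L' (R z\<^sub>0 g)))) x)"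
        unfolding resolvent[OF g, symmetric] resolvent[OF L'R0g, symmetric]
        using h by (simp add: field_simps)
    qed
  qed
  have "\<forall>\<^sub>F z in at z\<^sub>0. norm (operator_norm E \<theta>
      (\<lambda>g x. (R z g x - R z\<^sub>0 g x) / (z - z\<^sub>0) - R z\<^sub>0 (L' (R z\<^sub>0 g)) x)) \<le> 2 * (M * norm (z - z\<^sub>0))"
    unfolding eventually_at
    by (rule exI[of _ r]) (use r operator_norm_le[OF bound] in \<open>auto simp: dist_norm\<close>)
  moreover have "((\<lambda>z. 2 * (M * norm (z - z\<^sub>0))) \<longlongrightarrow> 0) (at z\<^sub>0)"
    by (rule tendsto_eq_intros refl | simp)+
  ultimately show ?thesis by (rule Lim_null_comparison)
qed

end

section \<open>Operators given by kernels on the fibres of the shift\<close>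

text \<open>
  Iterates of transfer operators have this form with a power of the shift, and their derivatives with respect to a
  parameter have it with \<open>n = 1\<close>.
\<close>

definition kernel_op :: "(nat \<Rightarrow> nat) set \<Rightarrow> nat \<Rightarrow> ((nat \<Rightarrow> nat) \<Rightarrow> complex) \<Rightarrow> operator" where
  "kernel_op E n K g x = (\<Sum>\<^sub>\<infinity>y\<in>{y \<in> E. (shift ^^ n) y = x}. K y * g y)"

lemma transfer_operator_eq_kernel_op: "transfer_operator E f = kernel_op E 1 (\<lambda>y. exp (f y))"
  by (simp add: transfer_operator_def kernel_op_def fun_eq_iff)

lemma infsum_diff_complex:
  fixes f g :: "'a \<Rightarrow> complex"
  assumes "f summable_on A" "g summable_on A"
  shows "(\<Sum>\<^sub>\<infinity>x\<in>A. f x - g x) = infsum f A - infsum g A"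
proof -
  have "((\<lambda>x. f x + - g x) has_sum (infsum f A + - infsum g A)) A"
    using assms by (intro has_sum_add has_sum_uminusI) auto
  then show ?thesis by (simp add: infsumI)
qed

context code_shift
begin

lemma word_weight_summable:
  assumes fin: "partition_sum E u n \<noteq> \<infinity>"
  defines "b \<equiv> \<lambda>w. enn2real (word_weight E u n w)"
  shows "b summable_on words E n" "infsum b (words E n) \<le> enn2real (partition_sum E u n)"
    "\<And>y. y \<in> E \<Longrightarrow> exp (birkhoff_sum n u y) \<le> b (initial_word n y)"
proof -
  have top: "word_weight E u n w < \<infinity>" if "w \<in> words E n" for w
    using sum_le_infsum_ennreal[of "{w}" "words E n" "word_weight E u n"] that fin
    by (auto simp: partition_sum_eq less_top[symmetric] top_unique)
  have le: "sum b F \<le> enn2real (partition_sum E u n)" if F: "finite F" "F \<subseteq> words E n" for F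
  proof -
    have "sum b F = enn2real (sum (word_weight E u n) F)"
      unfolding b_def by (subst enn2real_sum) (use F top in auto)
    also have "\<dots> \<le> enn2real (partition_sum E u n)"
      using sum_le_infsum_ennreal[OF F, of "word_weight E u n"] fin
      by (intro enn2real_mono) (auto simp: partition_sum_eq less_top)
    finally show ?thesis .
  qed
  show summable: "b summable_on words E n"
    by (rule nonneg_bdd_above_summable_on) (auto simp: b_def[abs_def] intro!: bdd_aboveI2 le[unfolded b_def])
  show "infsum b (words E n) \<le> enn2real (partition_sum E u n)"
    by (rule infsum_le_finite_sums[OF summable le])
  fix y assume y: "y \<in> E"
  have "ennreal (exp (birkhoff_sum n u y)) \<le> word_weight E u n (initial_word n y)"
    by (rule exp_birkhoff_le_word_weight[OF y])
  also have "\<dots> = ennreal (b (initial_word n y))"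
    unfolding b_def using top[of "initial_word n y"] y by (simp add: words_eq)
  finally show "exp (birkhoff_sum n u y) \<le> b (initial_word n y)" by (simp add: b_def)
qed

lemma inj_on_initial_word: "inj_on (initial_word n) {y \<in> E. (shift ^^ n) y = x}"
proof (rule inj_onI)
  fix y z assume yz: "y \<in> {y \<in> E. (shift ^^ n) y = x}" "z \<in> {y \<in> E. (shift ^^ n) y = x}"
    "initial_word n y = initial_word n z"
  have "y = glue (initial_word n y) x" "z = glue (initial_word n z) x"
    using yz(1,2) glue_initial_shift[of n y] glue_initial_shift[of n z] by auto
  then show "y = z" using yz(3) by metis
qed

text \<open>
  A point of a fibre of the \<open>n\<close>-th power of the shift is determined by its first \<open>n\<close> letters, so a sum over a
  fibre is at most the sum over all words of length \<open>n\<close>, uniformly in the base point.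
\<close>

lemma fibre_sum:
  fixes F :: "(nat \<Rightarrow> nat) \<Rightarrow> complex"
  assumes b: "\<And>w. 0 \<le> b w" "b summable_on words E n" and c: "0 \<le> c"
    and F: "\<And>y. y \<in> E \<Longrightarrow> (shift ^^ n) y = x \<Longrightarrow> norm (F y) \<le> b (initial_word n y) * c"
  shows "(\<lambda>y. norm (F y)) summable_on {y \<in> E. (shift ^^ n) y = x}"
    and "norm (infsum F {y \<in> E. (shift ^^ n) y = x}) \<le> infsum b (words E n) * c"
proof -
  let ?X = "{y \<in> E. (shift ^^ n) y = x}"
  have sub: "initial_word n ` ?X \<subseteq> words E n" by (auto simp: words_eq)
  have sI: "b summable_on initial_word n ` ?X" by (rule summable_on_subset_banach[OF b(2) sub])
  then have sX: "(b \<circ> initial_word n) summable_on ?X"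
    by (rule summable_on_reindex[OF inj_on_initial_word, THEN iffD1])
  then have sXc: "(\<lambda>y. b (initial_word n y) * c) summable_on ?X"
    by (intro summable_on_cmult_left) (simp add: o_def)
  show abs: "(\<lambda>y. norm (F y)) summable_on ?X"
    by (rule Infinite_Sum.abs_summable_on_comparison_test'[OF sXc]) (use F in auto)
  have "norm (infsum F ?X) \<le> (\<Sum>\<^sub>\<infinity>y\<in>?X. norm (F y))" by (rule norm_infsum_bound[OF abs])
  also have "\<dots> \<le> (\<Sum>\<^sub>\<infinity>y\<in>?X. b (initial_word n y) * c)"
    by (rule infsum_mono[OF abs sXc]) (use F in auto)
  also have "\<dots> = infsum b (initial_word n ` ?X) * c"
    by (simp add: infsum_reindex[OF inj_on_initial_word] infsum_cmult_left' o_def)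
  also have "\<dots> \<le> infsum b (words E n) * c"
    by (intro mult_right_mono infsum_mono2 sI b sub c)
  finally show "norm (infsum F ?X) \<le> infsum b (words E n) * c" .
qed

end

locale holder_shift = code_shift I A E + holder_space E \<theta>
  for I :: "nat set" and A :: "nat \<Rightarrow> nat \<Rightarrow> nat" and E :: "(nat \<Rightarrow> nat) set" and \<theta> :: real
begin

lemma kernel_abs_summable:
  assumes b: "\<And>w. 0 \<le> b w" "b summable_on words E n"
    and K: "\<And>y. y \<in> E \<Longrightarrow> norm (K y) \<le> b (initial_word n y)" and g: "g \<in> H"
  shows "(\<lambda>y. norm (K y * g y)) summable_on {y \<in> E. (shift ^^ n) y = x}"
proof -
  obtain c where c: "0 \<le> c" "holder_bound E \<theta> c g" using Holder_bddE[OF g] by blast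
  show ?thesis
    by (rule fibre_sum(1)[OF b c(1)])
      (auto simp: norm_mult intro!: mult_mono K holder_boundD(1)[OF c(2)] b)
qed

text \<open>
  If \<open>x\<close> and \<open>x'\<close> share their first letter, the same words may precede them, so exchanging the tail \<open>x\<close> for
  \<open>x'\<close> is a bijection of their fibres. The difference of the two sums is then estimated term by term. Each
  term contributes once through the variation of \<open>g\<close> and once through that of \<open>K\<close>, whence the factor \<open>2\<close>.
\<close>

lemma kernel_op_bounded:
  assumes b: "\<And>w. 0 \<le> b w" "b summable_on words E n"
    and K: "\<And>y. y \<in> E \<Longrightarrow> norm (K y) \<le> b (initial_word n y)"
    and dK: "\<And>k y y'. k \<ge> 1 \<Longrightarrow> y \<in> E \<Longrightarrow> y' \<in> E \<Longrightarrow> (\<And>i. i < n + k \<Longrightarrow> y i = y' i)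
      \<Longrightarrow> norm (K y - K y') \<le> b (initial_word n y) * \<theta> ^ k"
  shows "bounded_op E \<theta> (2 * infsum b (words E n)) (kernel_op E n K)"
proof -
  let ?X = "\<lambda>x. {y \<in> E. (shift ^^ n) y = x}" and ?B = "infsum b (words E n)"
  have B: "0 \<le> ?B" by (rule infsum_nonneg) (use b in auto)
  have sm: "(\<lambda>y. K y * g y) summable_on ?X x" if "g \<in> H" for g x
  proof (rule Infinite_Sum.abs_summable_summable)
    show "(\<lambda>y. norm (K y * g y)) summable_on ?X x"
      using b K that by (rule kernel_abs_summable)
  qed
  have zero: "kernel_op E n K g x = 0" if "x \<notin> E" for g x
  proof -
    have "?X x = {}" using that shift_pow_mem by auto
    then show ?thesis unfolding kernel_op_def by (simp only: infsum_empty)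
  qed
  have hb: "holder_bound E \<theta> (2 * ?B * c) (kernel_op E n K g)"
    if g: "g \<in> H" and c: "holder_bound E \<theta> c g" for g c
  proof (rule holder_boundI)
    fix x assume x: "x \<in> E"
    have c0: "0 \<le> c" using holder_boundD(1)[OF c x] norm_ge_zero[of "g x"] by linarith
    have "norm (kernel_op E n K g x) \<le> ?B * c"
      unfolding kernel_op_def
      by (rule fibre_sum(2)[OF b c0])
        (auto simp: norm_mult intro!: mult_mono K holder_boundD(1)[OF c] b)
    then show "norm (kernel_op E n K g x) \<le> 2 * ?B * c"
      using mult_nonneg_nonneg[OF B c0] by linarith
  next
    fix m x x' assume m: "(m::nat) \<ge> 1" and x: "x \<in> E" "x' \<in> E" and eq: "\<And>i. i < m \<Longrightarrow> x i = x' i"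
    have c0: "0 \<le> c" using holder_boundD(1)[OF c x(1)] norm_ge_zero[of "g x"] by linarith
    define \<phi> where "\<phi> y = glue (initial_word n y) x'" for y
    have \<phi>: "\<phi> y \<in> E" "(shift ^^ n) (\<phi> y) = x'" "\<And>i. i < n + m \<Longrightarrow> y i = \<phi> y i" if y: "y \<in> ?X x" for y
    proof -
      have yx: "y (i + n) = x i" for i using y by (auto simp: shift_pow)
      show "\<phi> y \<in> E"
        unfolding \<phi>_def using y x yx[of 0] eq[of 0] m by (intro glue_initial_word_mem) auto
      show "(shift ^^ n) (\<phi> y) = x'" unfolding \<phi>_def by (rule shift_glue) simp
      show "y i = \<phi> y i" if "i < n + m" for i
        using that yx[of "i - n"] eq[of "i - n"] by (auto simp: \<phi>_def glue_def)
    qed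
    have bij: "bij_betw \<phi> (?X x) (?X x')"
    proof (rule bij_betw_byWitness[where f' = "\<lambda>y. glue (initial_word n y) x"])
      show "\<forall>y\<in>?X x. glue (initial_word n (\<phi> y)) x = y"
        using glue_initial_shift by (auto simp: \<phi>_def)
      show "\<forall>y\<in>?X x'. \<phi> (glue (initial_word n y) x) = y"
        using glue_initial_shift by (auto simp: \<phi>_def)
      show "\<phi> ` ?X x \<subseteq> ?X x'" using \<phi>(1,2) by auto
      have "glue (initial_word n y) x \<in> ?X x" if y: "y \<in> ?X x'" for y
      proof -
        have "y n = x 0" using y eq[of 0] m by (auto simp: shift_pow)
        then show ?thesis using y x glue_initial_word_mem[of y x n] by (auto simp: shift_glue)
      qed
      then show "(\<lambda>y. glue (initial_word n y) x) ` ?X x' \<subseteq> ?X x" by auto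
    qed
    have "kernel_op E n K g x' = (\<Sum>\<^sub>\<infinity>y\<in>?X x. K (\<phi> y) * g (\<phi> y))"
      unfolding kernel_op_def by (rule infsum_reindex_bij_betw[OF bij, symmetric])
    moreover have "(\<lambda>y. K (\<phi> y) * g (\<phi> y)) summable_on ?X x"
      by (rule summable_on_reindex_bij_betw[OF bij, THEN iffD2, OF sm[OF g]])
    ultimately have "kernel_op E n K g x - kernel_op E n K g x'
        = (\<Sum>\<^sub>\<infinity>y\<in>?X x. K y * g y - K (\<phi> y) * g (\<phi> y))"
      by (simp add: kernel_op_def infsum_diff_complex[OF sm[OF g]])
    also have "norm \<dots> \<le> ?B * (2 * c * \<theta> ^ m)"
    proof (rule fibre_sum(2)[OF b])
      show "0 \<le> 2 * c * \<theta> ^ m" using c0 theta by simp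
      fix y assume y: "y \<in> E" "(shift ^^ n) y = x"
      then have y': "\<phi> y \<in> E" "\<And>i. i < n + m \<Longrightarrow> y i = \<phi> y i" using \<phi> by auto
      have "norm (g y - g (\<phi> y)) \<le> c * \<theta> ^ (n + m)"
        using m by (intro holder_boundD(2)[OF c] y y') auto
      also have "\<dots> \<le> c * \<theta> ^ m"
        using theta by (intro mult_left_mono c0 power_decreasing) auto
      finally have g1: "norm (g y - g (\<phi> y)) \<le> c * \<theta> ^ m" .
      have "norm (K y * g y - K (\<phi> y) * g (\<phi> y))
          = norm (K y * (g y - g (\<phi> y)) + (K y - K (\<phi> y)) * g (\<phi> y))"
        by (simp add: algebra_simps)
      also have "\<dots> \<le> b (initial_word n y) * (c * \<theta> ^ m) + (b (initial_word n y) * \<theta> ^ m) * c"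
        using theta m
        by (intro norm_triangle_mono)
          (auto simp: norm_mult intro!: mult_mono mult_nonneg_nonneg K dK g1 y y' holder_boundD(1)[OF c] b)
      also have "\<dots> = b (initial_word n y) * (2 * c * \<theta> ^ m)" by (simp add: algebra_simps)
      finally show "norm (K y * g y - K (\<phi> y) * g (\<phi> y)) \<le> b (initial_word n y) * (2 * c * \<theta> ^ m)" .
    qed
    finally show "norm (kernel_op E n K g x - kernel_op E n K g x') \<le> 2 * ?B * c * \<theta> ^ m"
      by (simp add: mult_ac)
  qed
  show ?thesis
    unfolding bounded_op_def
  proof (intro conjI ballI allI impI)
    show "0 \<le> 2 * ?B" using B by simp
    show "kernel_op E n K g \<in> H" if g: "g \<in> H" for g
      by (rule Holder_bddI[OF zero hb[OF g holder_bound_norm[OF g]]])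
    show "kernel_op E n K (\<lambda>x. g x + h x) = (\<lambda>x. kernel_op E n K g x + kernel_op E n K h x)"
      if "g \<in> H" "h \<in> H" for g h
      unfolding kernel_op_def distrib_left by (intro ext infsum_add sm that)
    show "kernel_op E n K (\<lambda>x. a * g x) = (\<lambda>x. a * kernel_op E n K g x)" for a g
      unfolding kernel_op_def mult.left_commute[of _ a] by (intro ext infsum_cmult_right')
  qed (use hb in auto)
qed

text \<open>
  The fibre of the \<open>n + 1\<close>-st power of the shift over \<open>x\<close> is the disjoint union of the fibres of the
  \<open>n\<close>-th power over the points of the first fibre; absolute summability, which the weights provide,
  allows the double sum to be rearranged.
\<close>

lemma kernel_op_funpow:
  fixes f :: "(nat \<Rightarrow> nat) \<Rightarrow> complex"
  assumes b: "\<And>n w. 0 \<le> b n w" "\<And>n. b n summable_on words E n"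
    and K: "\<And>n y. y \<in> E \<Longrightarrow> norm (exp (\<Sum>j<n. f ((shift ^^ j) y))) \<le> b n (initial_word n y)"
    and g: "g \<in> H"
  shows "(kernel_op E 1 (\<lambda>y. exp (f y)) ^^ n) g = kernel_op E n (\<lambda>y. exp (\<Sum>j<n. f ((shift ^^ j) y))) g"
proof (induction n)
  case 0
  have "kernel_op E 0 (\<lambda>y. exp (\<Sum>j<0. f ((shift ^^ j) y))) g x = g x" for x
  proof (cases "x \<in> E")
    case True
    then have "{y \<in> E. y = x} = {x}" by auto
    then show ?thesis by (simp add: kernel_op_def)
  next
    case False
    then have "{y \<in> E. y = x} = {}" by auto
    then show ?thesis using False g by (simp add: kernel_op_def Holder_bdd_zero)
  qed
  then show ?case by auto
next
  case (Suc n)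
  let ?F = "\<lambda>y. exp (\<Sum>j<Suc n. f ((shift ^^ j) y)) * g y"
  show ?case
  proof
    fix x
    let ?A = "{y \<in> E. shift y = x}" and ?B = "\<lambda>y. {z \<in> E. (shift ^^ n) z = y}"
    let ?C = "{z \<in> E. (shift ^^ Suc n) z = x}"
    have bij: "bij_betw (\<lambda>z. ((shift ^^ n) z, z)) ?C (Sigma ?A ?B)"
      by (rule bij_betw_byWitness[where f' = snd]) (auto intro: shift_pow_mem)
    have "?F summable_on ?C"
    proof (rule Infinite_Sum.abs_summable_summable)
      show "(\<lambda>y. norm (?F y)) summable_on ?C"
        using b[of "Suc n"] K[of _ "Suc n"] g by (rule kernel_abs_summable)
    qed
    then have sm: "(\<lambda>(y, z). ?F z) summable_on Sigma ?A ?B"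
      using summable_on_reindex_bij_betw[OF bij, of "\<lambda>(y, z). ?F z"] by simp
    have "(kernel_op E 1 (\<lambda>y. exp (f y)) ^^ Suc n) g x
        = (\<Sum>\<^sub>\<infinity>y\<in>?A. exp (f y) * (\<Sum>\<^sub>\<infinity>z\<in>?B y. exp (\<Sum>j<n. f ((shift ^^ j) z)) * g z))"
      by (simp only: funpow.simps comp_apply Suc.IH) (simp add: kernel_op_def)
    also have "\<dots> = (\<Sum>\<^sub>\<infinity>y\<in>?A. \<Sum>\<^sub>\<infinity>z\<in>?B y. ?F z)"
      unfolding infsum_cmult_right'[symmetric]
      by (intro infsum_cong) (auto simp: exp_add mult_ac)
    also have "\<dots> = (\<Sum>\<^sub>\<infinity>(y, z)\<in>Sigma ?A ?B. ?F z)"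
      using infsum_Sigma_banach[OF sm] by simp
    also have "\<dots> = infsum ?F ?C"
      using infsum_reindex_bij_betw[OF bij, of "\<lambda>(y, z). ?F z"] by simp
    finally show "(kernel_op E 1 (\<lambda>y. exp (f y)) ^^ Suc n) g x
        = kernel_op E (Suc n) (\<lambda>y. exp (\<Sum>j<Suc n. f ((shift ^^ j) y))) g x"
      by (simp add: kernel_op_def)
  qed
qed

end

section \<open>The family of potentials\<close>

locale potential_family = holder_shift +
  fixes \<eta> \<xi> :: "(nat \<Rightarrow> nat) \<Rightarrow> real" and V :: real
  assumes V: "0 \<le> V"
    and eta_var: "\<And>n x y. n \<ge> 1 \<Longrightarrow> x \<in> E \<Longrightarrow> y \<in> E \<Longrightarrow> (\<And>i. i < n \<Longrightarrow> x i = y i)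
      \<Longrightarrow> \<bar>\<eta> x - \<eta> y\<bar> \<le> V * \<theta> ^ n"
    and xi_var: "\<And>n x y. n \<ge> 1 \<Longrightarrow> x \<in> E \<Longrightarrow> y \<in> E \<Longrightarrow> (\<And>i. i < n \<Longrightarrow> x i = y i)
      \<Longrightarrow> \<bar>\<xi> x - \<xi> y\<bar> \<le> V * \<theta> ^ n"
    and xi_nonneg: "\<And>x. x \<in> E \<Longrightarrow> 0 \<le> \<xi> x"
begin

definition real_potential :: "real \<Rightarrow> (nat \<Rightarrow> nat) \<Rightarrow> real" where
  "real_potential t y = \<eta> y + t * \<xi> y"

definition potential :: "complex \<Rightarrow> (nat \<Rightarrow> nat) \<Rightarrow> complex" where
  "potential z y = complex_of_real (\<eta> y) + z * complex_of_real (\<xi> y)"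

abbreviation "Z t n \<equiv> enn2real (partition_sum E (real_potential t) n)"

abbreviation "L z \<equiv> transfer_operator E (potential z)"

lemma Re_potential: "Re (potential z y) = real_potential (Re z) y"
  by (simp add: potential_def real_potential_def)

lemma real_potential_mono: "y \<in> E \<Longrightarrow> s \<le> t \<Longrightarrow> real_potential s y \<le> real_potential t y"
  by (simp add: real_potential_def mult_right_mono xi_nonneg)

lemma birkhoff_sum_mono:
  "y \<in> E \<Longrightarrow> s \<le> t \<Longrightarrow> birkhoff_sum n (real_potential s) y \<le> birkhoff_sum n (real_potential t) y"
  unfolding birkhoff_sum_def by (intro sum_mono real_potential_mono shift_pow_mem)

lemma partition_sum_mono:
  assumes "s \<le> t"
  shows "partition_sum E (real_potential s) n \<le> partition_sum E (real_potential t) n"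
  unfolding partition_sum_eq
proof (rule infsum_mono)
  show "word_weight E (real_potential s) n w \<le> word_weight E (real_potential t) n w" for w
    unfolding word_weight_def
  proof (rule SUP_least)
    fix \<tau> assume \<tau>: "\<tau> \<in> cylinder E w"
    then have "\<tau> \<in> E" by (simp add: cylinder_def)
    then have "ennreal (exp (birkhoff_sum n (real_potential s) \<tau>))
        \<le> ennreal (exp (birkhoff_sum n (real_potential t) \<tau>))"
      using birkhoff_sum_mono[OF _ assms] by (simp add: ennreal_leI)
    also have "\<dots> \<le> (SUP \<tau>\<in>cylinder E w. ennreal (exp (birkhoff_sum n (real_potential t) \<tau>)))"
      by (rule SUP_upper[OF \<tau>])
    finally show "ennreal (exp (birkhoff_sum n (real_potential s) \<tau>)) \<le> \<dots>" .
  qed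
qed (auto intro: nonneg_summable_on_complete)

lemma potential_var:
  assumes "n \<ge> 1" "x \<in> E" "y \<in> E" "\<And>i. i < n \<Longrightarrow> x i = y i"
  shows "norm (potential z x - potential z y) \<le> (1 + norm z) * V * \<theta> ^ n"
proof -
  have "potential z x - potential z y = of_real (\<eta> x - \<eta> y) + z * of_real (\<xi> x - \<xi> y)"
    by (simp add: potential_def algebra_simps)
  also have "norm \<dots> \<le> \<bar>\<eta> x - \<eta> y\<bar> + norm z * \<bar>\<xi> x - \<xi> y\<bar>"
    by (rule order.trans[OF norm_triangle_ineq]) (simp add: norm_mult del: of_real_diff)
  also have "\<dots> \<le> V * \<theta> ^ n + norm z * (V * \<theta> ^ n)"
    by (intro add_mono mult_left_mono eta_var xi_var assms norm_ge_zero)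
  finally show ?thesis by (simp add: algebra_simps)
qed

text \<open>
  After \<open>j\<close> shifts the sequences still share \<open>n + k - j\<close> letters, so the variations of the summands form a
  geometric sequence ending at \<open>\<theta>\<^sup>k\<close>. The bound does not depend on \<open>n\<close>.
\<close>

lemma birkhoff_potential_var:
  assumes k: "k \<ge> 1" and y: "y \<in> E" "y' \<in> E" and eq: "\<And>i. i < n + k \<Longrightarrow> y i = y' i"
  shows "norm ((\<Sum>j<n. potential z ((shift ^^ j) y)) - (\<Sum>j<n. potential z ((shift ^^ j) y')))
    \<le> (1 + norm z) * V / (1 - \<theta>) * \<theta> ^ k"
proof -
  have "norm (\<Sum>j<n. potential z ((shift ^^ j) y) - potential z ((shift ^^ j) y'))
      \<le> (\<Sum>j<n. (1 + norm z) * V * \<theta> ^ (n + k - j))"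
  proof (rule sum_norm_le)
    fix j assume j: "j \<in> {..<n}"
    show "norm (potential z ((shift ^^ j) y) - potential z ((shift ^^ j) y'))
        \<le> (1 + norm z) * V * \<theta> ^ (n + k - j)"
      by (rule potential_var) (use j k y eq in \<open>auto intro: shift_pow_mem[unfolded shift_pow] simp: shift_pow\<close>)
  qed
  also have "\<dots> \<le> (\<Sum>j<n. (1 + norm z) * V * \<theta> ^ k * \<theta> ^ (n - Suc j))"
  proof (rule sum_mono)
    fix j assume "j \<in> {..<n}"
    then have "\<theta> ^ (n + k - j) \<le> \<theta> ^ (k + (n - Suc j))"
      using theta by (intro power_decreasing) auto
    then show "(1 + norm z) * V * \<theta> ^ (n + k - j) \<le> (1 + norm z) * V * \<theta> ^ k * \<theta> ^ (n - Suc j)"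
      using V by (simp add: power_add mult.assoc mult_left_mono)
  qed
  also have "\<dots> = (1 + norm z) * V * \<theta> ^ k * (\<Sum>j<n. \<theta> ^ j)"
    by (simp add: sum_distrib_left[symmetric] sum.nat_diff_reindex)
  also have "\<dots> \<le> (1 + norm z) * V * \<theta> ^ k * (1 / (1 - \<theta>))"
  proof (rule mult_left_mono)
    show "(\<Sum>j<n. \<theta> ^ j) \<le> 1 / (1 - \<theta>)"
      using theta by (simp add: sum_gp_strict divide_right_mono)
  qed (use V theta in auto)
  finally show ?thesis by (simp add: sum_subtractf)
qed

lemma weight:
  assumes fin: "partition_sum E (real_potential t) 1 \<noteq> \<infinity>"
  defines "b \<equiv> \<lambda>n w. enn2real (word_weight E (real_potential t) n w)"
  shows "0 \<le> b n w" "b n summable_on words E n" "infsum (b n) (words E n) \<le> Z t n"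
    "\<And>y s. y \<in> E \<Longrightarrow> s \<le> t \<Longrightarrow> exp (birkhoff_sum n (real_potential s) y) \<le> b n (initial_word n y)"
proof -
  note w = word_weight_summable[OF partition_sum_finite[OF fin, of n]]
  show "0 \<le> b n w" by (simp add: b_def)
  show "b n summable_on words E n" "infsum (b n) (words E n) \<le> Z t n"
    unfolding b_def by (rule w)+
  show "exp (birkhoff_sum n (real_potential s) y) \<le> b n (initial_word n y)" if "y \<in> E" "s \<le> t" for y s
    using w(3)[OF that(1)] birkhoff_sum_mono[OF that, of n] unfolding b_def
    by (meson exp_le_cancel_iff order_trans)
qed

text \<open>
  The partition sum on the right belongs to the real parameter \<open>t\<close> and the constant in front of it to \<open>M\<close>, so
  the bound is uniform on bounded parts of the half-plane \<open>Re z \<le> t\<close>. The moduli of the kernel of the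
  \<open>n\<close>-th iterate are at most the cylinder weights for \<open>t\<close>, and its variations are at most
  these weights times the variations of the complex Birkhoff sums.
\<close>

lemma transfer_funpow_bounded:
  assumes fin: "partition_sum E (real_potential t) 1 \<noteq> \<infinity>" and z: "Re z \<le> t" "norm z \<le> M"
  shows "bounded_op E \<theta> (2 * ((1 + (1 + M) * V / (1 - \<theta>)) * Z t n)) (L z ^^ n)"
proof -
  define b where "b = (\<lambda>n w. enn2real (word_weight E (real_potential t) n w))"
  define S where "S n y = (\<Sum>j<n. potential z ((shift ^^ j) y))" for n y
  define D where "D = (1 + M) * V / (1 - \<theta>)"
  have M: "0 \<le> M" using z(2) norm_ge_zero[of z] by linarith
  have D: "0 \<le> D" using V theta M by (simp add: D_def)
  have w: "0 \<le> b n w" "b n summable_on words E n" "infsum (b n) (words E n) \<le> Z t n"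
    "\<And>y s. y \<in> E \<Longrightarrow> s \<le> t \<Longrightarrow> exp (birkhoff_sum n (real_potential s) y) \<le> b n (initial_word n y)"
    for n w
    unfolding b_def by (rule weight[OF fin]; assumption)+
  have Re_S: "Re (S n y) = birkhoff_sum n (real_potential (Re z)) y" for n y
    by (simp add: S_def birkhoff_sum_def Re_potential)
  have K: "norm (exp (S n y)) \<le> b n (initial_word n y)" if "y \<in> E" for n y
    using w(4)[OF that z(1), of n] by (simp add: Re_S)
  have bD: "b n w \<le> (1 + D) * b n w" for n w
    using mult_nonneg_nonneg[OF D w(1)[of n w]] by (simp add: distrib_right)
  have "bounded_op E \<theta> (2 * infsum (\<lambda>w. (1 + D) * b n w) (words E n)) (kernel_op E n (\<lambda>y. exp (S n y)))"
  proof (rule kernel_op_bounded)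
    show "0 \<le> (1 + D) * b n w" for w using bD[of n w] w(1)[of n w] by linarith
    show "(\<lambda>w. (1 + D) * b n w) summable_on words E n" by (intro summable_on_cmult_right w(2))
    show "norm (exp (S n y)) \<le> (1 + D) * b n (initial_word n y)" if "y \<in> E" for y
      using K[OF that] bD order_trans by blast
    fix k y y' assume k: "(k::nat) \<ge> 1" and y: "y \<in> E" "y' \<in> E" and eq: "\<And>i. i < n + k \<Longrightarrow> y i = y' i"
    have iw: "initial_word n y' = initial_word n y" using eq by (auto simp: initial_word_eq_iff)
    have pos: "0 < b n (initial_word n y)" using K[OF y(1), of n] by (auto intro: less_le_trans[rotated])
    have "norm (exp (S n y) - exp (S n y')) \<le> norm (S n y - S n y') * exp (ln (b n (initial_word n y)))"
    proof (rule norm_exp_diff_le)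
      show "Re (S n y) \<le> ln (b n (initial_word n y))" "Re (S n y') \<le> ln (b n (initial_word n y))"
        using K[OF y(1), of n] K[OF y(2), of n] pos unfolding iw by (simp_all add: ln_ge_iff)
    qed
    also have "\<dots> \<le> (D * \<theta> ^ k) * b n (initial_word n y)"
    proof (rule mult_mono)
      have "norm (S n y - S n y') \<le> (1 + norm z) * V / (1 - \<theta>) * \<theta> ^ k"
        unfolding S_def by (rule birkhoff_potential_var[OF k y eq])
      also have "\<dots> \<le> D * \<theta> ^ k"
        unfolding D_def using z(2) V theta by (intro mult_right_mono divide_right_mono) auto
      finally show "norm (S n y - S n y') \<le> D * \<theta> ^ k" .
    qed (use pos D theta in auto)
    also have "\<dots> \<le> (1 + D) * b n (initial_word n y) * \<theta> ^ k"
      using pos theta by (simp add: algebra_simps)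
    finally show "norm (exp (S n y) - exp (S n y')) \<le> (1 + D) * b n (initial_word n y) * \<theta> ^ k" .
  qed
  moreover have "2 * infsum (\<lambda>w. (1 + D) * b n w) (words E n) \<le> 2 * ((1 + D) * Z t n)"
    using w(3)[of n] D by (simp add: infsum_cmult_right' mult_left_mono)
  ultimately have "bounded_op E \<theta> (2 * ((1 + D) * Z t n)) (kernel_op E n (\<lambda>y. exp (S n y)))"
    by (rule bounded_op_mono)
  then show ?thesis
    unfolding D_def
  proof (rule bounded_op_cong)
    show "(L z ^^ n) g = kernel_op E n (\<lambda>y. exp (S n y)) g" if "g \<in> H" for g
      unfolding transfer_operator_eq_kernel_op S_def
      by (rule kernel_op_funpow[OF w(1,2) K[unfolded S_def] that])
  qed
qed

text \<open>
  An additional weight \<open>\<psi>(\<xi>)\<close>, where \<open>\<psi> 0 = 0\<close> and the Lipschitz constants of \<open>\<psi>\<close> on \<open>[0, s]\<close> grow no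
  faster than \<open>exp (q s)\<close>, is tolerated at the price of moving the real part of the parameter to the right by \<open>q + r\<close>: here \<open>q\<close> pays for the exponential, and \<open>r\<close> for the
  linear factor, by \<open>s \<le> exp (r s) / r\<close>. In the constant \<open>c\<close> the first summand bounds the kernel itself, the second
  the variation of \<open>\<psi>(\<xi>)\<close> and the third the variation of the exponential; the factors
  \<open>exp (q V)\<close> and \<open>exp ((q + r) V)\<close> pass between two points of the same cylinder, on which \<open>\<xi>\<close> varies by at
  most \<open>V\<close>.
\<close>

lemma weighted_transfer_bounded:
  fixes \<psi> :: "real \<Rightarrow> complex"
  assumes fin: "partition_sum E (real_potential t) 1 \<noteq> \<infinity>"
    and r: "0 < r" and q: "0 \<le> q" and t: "Re z + q + r \<le> t" and m: "0 \<le> m"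
    and \<psi>0: "\<psi> 0 = 0"
    and \<psi>: "\<And>s s'. 0 \<le> s \<Longrightarrow> 0 \<le> s' \<Longrightarrow> norm (\<psi> s - \<psi> s') \<le> m * \<bar>s - s'\<bar> * exp (q * max s s')"
  defines "c \<equiv> 1 / r + V * exp (q * V) + (1 + norm z) * V / r * exp ((q + r) * V)"
  shows "bounded_op E \<theta> (m * (2 * c * Z t 1)) (kernel_op E 1 (\<lambda>y. exp (potential z y) * \<psi> (\<xi> y)))"
    and "\<And>g x. g \<in> H \<Longrightarrow> (\<lambda>y. exp (potential z y) * \<psi> (\<xi> y) * g y) summable_on {y \<in> E. (shift ^^ 1) y = x}"
proof -
  define b where "b = (\<lambda>w. enn2real (word_weight E (real_potential t) 1 w))"
  have b: "0 \<le> b w" "b summable_on words E 1" "infsum b (words E 1) \<le> Z t 1" for w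
    unfolding b_def by (rule weight[OF fin])+
  have wt: "exp (\<eta> y + s * \<xi> y) \<le> b (initial_word 1 y)" if "y \<in> E" "s \<le> t" for y s
    using weight(4)[OF fin that, of 1] by (simp add: b_def birkhoff_sum_def real_potential_def)
  let ?K = "\<lambda>y. exp (potential z y) * \<psi> (\<xi> y)"
  have \<psi>_le: "norm (\<psi> s) \<le> m / r * exp ((q + r) * s)" if s: "0 \<le> s" for s
  proof -
    have "norm (\<psi> s) \<le> m * s * exp (q * s)" using \<psi>[of s 0] s by (simp add: \<psi>0)
    also have "\<dots> \<le> m * (exp (r * s) / r) * exp (q * s)"
    proof -
      have "r * s \<le> exp (r * s)" using exp_ge_add_one_self[of "r * s"] by linarith
      then have "s \<le> exp (r * s) / r" using r by (simp add: field_simps)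
      then show ?thesis using m by (intro mult_right_mono mult_left_mono) auto
    qed
    also have "\<dots> = m / r * exp ((q + r) * s)" by (simp add: exp_add[symmetric] algebra_simps)
    finally show ?thesis .
  qed
  have c: "1 / r \<le> c" "V * exp (q * V) + (1 + norm z) * V / r * exp ((q + r) * V) \<le> c"
    using V r by (auto simp: c_def)
  have c0: "0 \<le> c" using c(1) r by (meson divide_nonneg_pos order_trans zero_le_one)
  have mcb: "a * m * b w \<le> m * c * b w" if "a \<le> c" for a w
    using mult_right_mono[OF that, of "m * b w"] b(1)[of w] m by (simp add: mult_ac)
  have K: "norm (?K y) \<le> m * c * b (initial_word 1 y)" if y: "y \<in> E" for y
  proof -
    have "norm (?K y) \<le> exp (\<eta> y + Re z * \<xi> y) * (m / r * exp ((q + r) * \<xi> y))"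
      unfolding norm_mult using xi_nonneg[OF y]
      by (intro mult_mono \<psi>_le) (auto simp: Re_potential real_potential_def)
    also have "\<dots> = m / r * exp (\<eta> y + (Re z + q + r) * \<xi> y)"
      by (simp add: exp_add[symmetric] algebra_simps)
    also have "\<dots> \<le> m / r * b (initial_word 1 y)"
      using m r by (intro mult_left_mono wt y t) auto
    also have "\<dots> = 1 / r * m * b (initial_word 1 y)" by simp
    also have "\<dots> \<le> m * c * b (initial_word 1 y)" by (rule mcb[OF c(1)])
    finally show ?thesis .
  qed
  have mcb0: "0 \<le> m * c * b w" for w using m c0 b(1) by simp
  have sm: "(\<lambda>w. m * c * b w) summable_on words E 1" by (intro summable_on_cmult_right b(2))
  have "bounded_op E \<theta> (2 * infsum (\<lambda>w. m * c * b w) (words E 1)) (kernel_op E 1 ?K)"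
  proof (rule kernel_op_bounded)
    fix k y y' assume k: "(k::nat) \<ge> 1" and y: "y \<in> E" "y' \<in> E" and eq: "\<And>i. i < 1 + k \<Longrightarrow> y i = y' i"
    define s s' where "s = \<xi> y" and "s' = \<xi> y'"
    define w where "w = initial_word 1 y"
    have w': "initial_word 1 y' = w" using eq by (auto simp: w_def initial_word_eq_iff)
    have s: "0 \<le> s" "0 \<le> s'" using xi_nonneg y by (auto simp: s_def s'_def)
    have pw: "\<theta> ^ (1 + k) \<le> \<theta> ^ k" "\<theta> ^ (1 + k) \<le> 1"
      using theta by (auto intro!: power_decreasing power_le_one simp del: power_Suc)
    have ds: "\<bar>s - s'\<bar> \<le> V * \<theta> ^ k" "\<bar>s - s'\<bar> \<le> V"
    proof -
      have "\<bar>s - s'\<bar> \<le> V * \<theta> ^ (1 + k)" unfolding s_def s'_def by (rule xi_var) (use y eq in auto)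
      then show "\<bar>s - s'\<bar> \<le> V * \<theta> ^ k" "\<bar>s - s'\<bar> \<le> V"
        using mult_left_mono[OF pw(1) V] mult_left_mono[OF pw(2) V] by linarith+
    qed
    have dp: "norm (potential z y - potential z y') \<le> (1 + norm z) * V * \<theta> ^ k"
    proof -
      have "norm (potential z y - potential z y') \<le> (1 + norm z) * V * \<theta> ^ (1 + k)"
        by (rule potential_var) (use y eq in auto)
      also have "\<dots> \<le> (1 + norm z) * V * \<theta> ^ k" using V by (intro mult_left_mono pw) auto
      finally show ?thesis .
    qed
    have wy: "exp (\<eta> y + a * s) \<le> b w" "exp (\<eta> y' + a * s') \<le> b w" if "a \<le> t" for a
    proof -
      show "exp (\<eta> y + a * s) \<le> b w" unfolding s_def w_def by (rule wt[OF y(1) that])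
      show "exp (\<eta> y' + a * s') \<le> b w" unfolding s'_def w'[symmetric] by (rule wt[OF y(2) that])
    qed
    \<comment> \<open>the contribution of the variation of \<open>\<psi>(\<xi>)\<close>\<close>
    have first: "norm (exp (potential z y) * (\<psi> s - \<psi> s')) \<le> m * (V * exp (q * V)) * \<theta> ^ k * b w"
    proof -
      have "norm (exp (potential z y) * (\<psi> s - \<psi> s'))
          \<le> exp (\<eta> y + Re z * s) * (m * (V * \<theta> ^ k) * exp (q * (s + V)))"
        unfolding norm_mult
      proof (rule mult_mono)
        show "norm (exp (potential z y)) \<le> exp (\<eta> y + Re z * s)"
          by (simp add: Re_potential real_potential_def s_def)
        have "norm (\<psi> s - \<psi> s') \<le> m * \<bar>s - s'\<bar> * exp (q * max s s')" by (rule \<psi>[OF s])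
        also have "\<dots> \<le> m * (V * \<theta> ^ k) * exp (q * (s + V))"
        proof (rule mult_mono)
          show "m * \<bar>s - s'\<bar> \<le> m * (V * \<theta> ^ k)" by (intro mult_left_mono ds m)
          have "max s s' \<le> s + V" using ds(2) V by linarith
          then show "exp (q * max s s') \<le> exp (q * (s + V))" using q by (simp add: mult_left_mono)
        qed (use m V theta in auto)
        finally show "norm (\<psi> s - \<psi> s') \<le> m * (V * \<theta> ^ k) * exp (q * (s + V))" .
      qed auto
      also have "\<dots> = m * (V * exp (q * V)) * \<theta> ^ k * exp (\<eta> y + (Re z + q) * s)"
        by (simp add: exp_add algebra_simps)
      also have "\<dots> \<le> m * (V * exp (q * V)) * \<theta> ^ k * b w"
        using m V theta r t by (intro mult_left_mono wy) auto
      finally show ?thesis .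
    qed
    \<comment> \<open>the contribution of the variation of the exponential\<close>
    have second: "norm ((exp (potential z y) - exp (potential z y')) * \<psi> s')
        \<le> m * ((1 + norm z) * V / r * exp ((q + r) * V)) * \<theta> ^ k * b w"
    proof -
      define p where "p = max (\<eta> y + Re z * s) (\<eta> y' + Re z * s')"
      \<comment> \<open>The maximum may be attained at \<open>y\<close> while \<open>s'\<close> belongs to \<open>y'\<close>; then \<open>s'\<close> is replaced by \<open>s + V\<close>.\<close>
      have e: "exp p * exp ((q + r) * s') \<le> exp ((q + r) * V) * b w"
      proof (cases "p = \<eta> y + Re z * s")
        case True
        have "(q + r) * s' \<le> (q + r) * (s + V)" using ds(2) q r by (intro mult_left_mono) auto
        then have "exp p * exp ((q + r) * s') \<le> exp ((q + r) * V + (\<eta> y + (Re z + q + r) * s))"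
          unfolding exp_add[symmetric] True by (simp add: algebra_simps)
        also have "\<dots> = exp ((q + r) * V) * exp (\<eta> y + (Re z + q + r) * s)" by (rule exp_add)
        also have "\<dots> \<le> exp ((q + r) * V) * b w" by (intro mult_left_mono wy t) auto
        finally show ?thesis .
      next
        case False
        then have "p = \<eta> y' + Re z * s'" by (auto simp: p_def max_def split: if_splits)
        then have "exp p * exp ((q + r) * s') = 1 * exp (\<eta> y' + (Re z + q + r) * s')"
          by (simp add: exp_add[symmetric] algebra_simps)
        also have "\<dots> \<le> exp ((q + r) * V) * b w"
          using q r V by (intro mult_mono wy t) auto
        finally show ?thesis .
      qed
      have "norm (exp (potential z y) - exp (potential z y')) \<le> norm (potential z y - potential z y') * exp p"
        by (rule norm_exp_diff_le) (auto simp: p_def Re_potential real_potential_def s_def s'_def)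
      also have "\<dots> \<le> (1 + norm z) * V * \<theta> ^ k * exp p" by (intro mult_right_mono dp) auto
      finally have "norm ((exp (potential z y) - exp (potential z y')) * \<psi> s')
          \<le> ((1 + norm z) * V * \<theta> ^ k * exp p) * (m / r * exp ((q + r) * s'))"
        unfolding norm_mult using V theta by (intro mult_mono \<psi>_le s) auto
      also have "\<dots> = (1 + norm z) * V * \<theta> ^ k * (m / r) * (exp p * exp ((q + r) * s'))"
        by (simp add: mult_ac)
      also have "\<dots> \<le> (1 + norm z) * V * \<theta> ^ k * (m / r) * (exp ((q + r) * V) * b w)"
        using V theta m r by (intro mult_left_mono e) auto
      finally show ?thesis by (simp add: mult_ac)
    qed
    have "?K y - ?K y' = exp (potential z y) * (\<psi> s - \<psi> s') + (exp (potential z y) - exp (potential z y')) * \<psi> s'"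
      by (simp add: s_def s'_def algebra_simps)
    then have "norm (?K y - ?K y') \<le> m * (V * exp (q * V)) * \<theta> ^ k * b w
        + m * ((1 + norm z) * V / r * exp ((q + r) * V)) * \<theta> ^ k * b w"
      using norm_triangle_mono[OF first second] by simp
    also have "\<dots> = ((V * exp (q * V) + (1 + norm z) * V / r * exp ((q + r) * V)) * m * b w) * \<theta> ^ k"
      by (simp add: algebra_simps)
    also have "\<dots> \<le> (m * c * b w) * \<theta> ^ k"
      using theta by (intro mult_right_mono mcb c(2)) auto
    finally show "norm (?K y - ?K y') \<le> m * c * b (initial_word 1 y) * \<theta> ^ k" by (simp add: w_def)
  qed (use mcb0 sm K in auto)
  moreover have "2 * infsum (\<lambda>w. m * c * b w) (words E 1) \<le> m * (2 * c * Z t 1)"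
    using mult_left_mono[OF b(3), of "m * c"] m c0 by (simp add: infsum_cmult_right')
  ultimately show "bounded_op E \<theta> (m * (2 * c * Z t 1)) (kernel_op E 1 ?K)"
    by (rule bounded_op_mono)
  show "(\<lambda>y. ?K y * g y) summable_on {y \<in> E. (shift ^^ 1) y = x}" if "g \<in> H" for g x
  proof (rule Infinite_Sum.abs_summable_summable)
    show "(\<lambda>y. norm (?K y * g y)) summable_on {y \<in> E. (shift ^^ 1) y = x}"
      using mcb0 sm K that by (rule kernel_abs_summable)
  qed
qed

lemma real_potential_var:
  assumes "x \<in> E" "y \<in> E" "x 0 = y 0"
  shows "\<bar>real_potential t x - real_potential t y\<bar> \<le> (1 + \<bar>t\<bar>) * V * \<theta>"
proof -
  have "\<bar>real_potential t x - real_potential t y\<bar> = norm (potential (of_real t) x - potential (of_real t) y)"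
    by (simp add: potential_def real_potential_def flip: of_real_add of_real_mult of_real_diff)
  also have "\<dots> \<le> (1 + norm (of_real t :: complex)) * V * \<theta> ^ 1"
    by (rule potential_var) (use assms in auto)
  finally show ?thesis by simp
qed

text \<open>
  The pressure is nondecreasing in \<open>t\<close> since the partition sums are, so it is at most \<open>0\<close> to the left of its
  zero \<open>s\<close>; uniqueness of the zero excludes equality.
\<close>

lemma summable_below_unique_zero:
  assumes irr: "finitely_irreducible I A" and zero: "pressure E (real_potential s) = 0"
    and unique: "\<And>t. pressure E (real_potential t) = 0 \<Longrightarrow> t = s" and t: "t < s"
  shows "partition_sum E (real_potential t) 1 \<noteq> \<infinity>" "summable (Z t)"
proof -
  have E: "E \<noteq> {}" and fin_s: "partition_sum E (real_potential s) 1 \<noteq> \<infinity>"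
    by (rule pressure_zero_imp_finite[OF irr _ zero]; rule real_potential_var; assumption)+
  show fin_t: "partition_sum E (real_potential t) 1 \<noteq> \<infinity>"
    using partition_sum_mono[OF less_imp_le[OF t], of 1] fin_s by (auto simp: top_unique)
  have "pressure E (real_potential t) \<le> pressure E (real_potential s)"
  proof (rule LIMSEQ_le[OF pressure_tendsto[OF E fin_t] pressure_tendsto[OF E fin_s]])
    have "ln (Z t n) / real n \<le> ln (Z s n) / real n" for n
    proof (intro divide_right_mono)
      have "0 < Z t n"
        using partition_sum_pos[OF E, of "real_potential t" n] partition_sum_finite[OF fin_t, of n]
        by (auto simp: enn2real_positive_iff less_top)
      moreover have "Z t n \<le> Z s n"
        using partition_sum_mono[OF less_imp_le[OF t], of n] partition_sum_finite[OF fin_s, of n]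
        by (intro enn2real_mono) (auto simp: less_top)
      ultimately show "ln (Z t n) \<le> ln (Z s n)" by simp
    qed simp
    then show "\<exists>N. \<forall>n\<ge>N. ereal (ln (Z t n) / real n) \<le> ereal (ln (Z s n) / real n)" by simp
  qed
  moreover have "pressure E (real_potential t) \<noteq> 0" using unique t by blast
  ultimately have "pressure E (real_potential t) < 0" using zero by (simp add: order_less_le)
  then show "summable (Z t)" by (rule partition_sum_summable[OF E fin_t])
qed

lemma transfer_summable:
  assumes fin: "partition_sum E (real_potential t) 1 \<noteq> \<infinity>" and z: "Re z \<le> t" and g: "g \<in> H"
  shows "(\<lambda>y. exp (potential z y) * g y) summable_on {y \<in> E. (shift ^^ 1) y = x}"
proof (rule Infinite_Sum.abs_summable_summable)
  have "norm (exp (potential z y)) \<le> enn2real (word_weight E (real_potential t) 1 (initial_word 1 y))"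
    if "y \<in> E" for y
    using weight(4)[OF fin that z, of 1] by (simp add: Re_potential birkhoff_sum_def)
  with weight(1,2)[OF fin, where n = 1]
  show "(\<lambda>y. norm (exp (potential z y) * g y)) summable_on {y \<in> E. (shift ^^ 1) y = x}"
    using g by (rule kernel_abs_summable)
qed

lemma transfer_bounded:
  assumes fin: "partition_sum E (real_potential t) 1 \<noteq> \<infinity>" and z: "Re z \<le> t" "norm z \<le> M"
  shows "bounded_op E \<theta> (2 * ((1 + (1 + M) * V / (1 - \<theta>)) * Z t 1)) (L z)"
  using transfer_funpow_bounded[OF fin z, of 1] by simp

section \<open>Holomorphy of the resolvent\<close>

definition transfer_deriv :: "complex \<Rightarrow> operator" where
  "transfer_deriv z = kernel_op E 1 (\<lambda>y. exp (potential z y) * complex_of_real (\<xi> y))"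

text \<open>
  The derivative and the remainder of order two are both weighted transfer operators, for \<open>\<psi> s = s\<close> and for
  \<open>\<psi> s = exp (h s) - 1 - h s\<close>. Each is treated with the rate \<open>q = 2 r\<close>, so together with the additional \<open>r\<close>
  of the weighted estimate the real part moves by \<open>3 r\<close>.
\<close>

lemma transfer_differentiable:
  assumes fin: "partition_sum E (real_potential t) 1 \<noteq> \<infinity>" and r: "0 < r" and t: "Re z\<^sub>0 + 3 * r \<le> t"
  obtains K where "bounded_op E \<theta> K (transfer_deriv z\<^sub>0)"
    "\<And>z. norm (z - z\<^sub>0) \<le> r \<Longrightarrow> bounded_op E \<theta> (K / r * norm (z - z\<^sub>0) ^ 2)
      (\<lambda>g x. L z g x - L z\<^sub>0 g x - (z - z\<^sub>0) * transfer_deriv z\<^sub>0 g x)"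
proof -
  define K where "K = 2 * (1 / r + V * exp (2 * r * V) + (1 + norm z\<^sub>0) * V / r * exp ((2 * r + r) * V)) * Z t 1"
  have t': "Re z\<^sub>0 + 2 * r + r \<le> t" using t by simp
  have lip: "norm (complex_of_real s - complex_of_real s') \<le> 1 * \<bar>s - s'\<bar> * exp (2 * r * max s s')"
    if "0 \<le> s" "0 \<le> s'" for s s'
  proof -
    have "\<bar>s - s'\<bar> * 1 \<le> \<bar>s - s'\<bar> * exp (2 * r * max s s')"
      using that r by (intro mult_left_mono) (auto simp: max_def)
    then show ?thesis by (simp flip: of_real_diff)
  qed
  have deriv: "bounded_op E \<theta> (1 * K) (transfer_deriv z\<^sub>0)"
    unfolding K_def transfer_deriv_def
    by (rule weighted_transfer_bounded(1)[OF fin r _ t' _ _ lip]) (use r in auto)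
  have deriv_summable: "(\<lambda>y. exp (potential z\<^sub>0 y) * complex_of_real (\<xi> y) * g y)
      summable_on {y \<in> E. (shift ^^ 1) y = x}" if "g \<in> H" for g x
    by (rule weighted_transfer_bounded(2)[OF fin r _ t' _ _ lip that]) (use r in auto)
  show ?thesis
  proof (rule that)
    show "bounded_op E \<theta> K (transfer_deriv z\<^sub>0)"
      using deriv by simp
    fix z assume z: "norm (z - z\<^sub>0) \<le> r"
    define h where "h = z - z\<^sub>0"
    have h: "norm h \<le> r" using z by (simp add: h_def)
    define \<psi> where "\<psi> s = exp (h * complex_of_real s) - 1 - h * complex_of_real s" for s
    have "bounded_op E \<theta> (norm h ^ 2 / r * K) (kernel_op E 1 (\<lambda>y. exp (potential z\<^sub>0 y) * \<psi> (\<xi> y)))"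
      unfolding K_def
    proof (rule weighted_transfer_bounded(1)[OF fin r _ t'])
      show "norm (\<psi> s - \<psi> s') \<le> norm h ^ 2 / r * \<bar>s - s'\<bar> * exp (2 * r * max s s')"
        if "0 \<le> s" "0 \<le> s'" for s s'
        unfolding \<psi>_def by (rule exp_remainder_lipschitz[OF that h r])
    qed (use r in \<open>auto simp: \<psi>_def\<close>)
    then have "bounded_op E \<theta> (K / r * norm h ^ 2) (kernel_op E 1 (\<lambda>y. exp (potential z\<^sub>0 y) * \<psi> (\<xi> y)))"
      by (simp add: mult_ac)
    then show "bounded_op E \<theta> (K / r * norm (z - z\<^sub>0) ^ 2)
        (\<lambda>g x. L z g x - L z\<^sub>0 g x - (z - z\<^sub>0) * transfer_deriv z\<^sub>0 g x)"
      unfolding h_def[symmetric]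
    proof (rule bounded_op_cong)
      fix g assume g: "g \<in> H"
      have Re: "Re z \<le> t" "Re z\<^sub>0 \<le> t"
        using abs_Re_le_cmod[of h] h t r by (auto simp: h_def)
      have kernel: "exp (potential z\<^sub>0 y) * \<psi> (\<xi> y) * g y
          = exp (potential z y) * g y - exp (potential z\<^sub>0 y) * g y
            - h * (exp (potential z\<^sub>0 y) * complex_of_real (\<xi> y) * g y)" for y
      proof -
        have "potential z y = potential z\<^sub>0 y + h * complex_of_real (\<xi> y)"
          by (simp add: potential_def h_def algebra_simps)
        then show ?thesis by (simp add: \<psi>_def exp_add algebra_simps)
      qed
      show "(\<lambda>x. L z g x - L z\<^sub>0 g x - h * transfer_deriv z\<^sub>0 g x)
          = kernel_op E 1 (\<lambda>y. exp (potential z\<^sub>0 y) * \<psi> (\<xi> y)) g"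
      proof
        fix x
        let ?X = "{y \<in> E. (shift ^^ 1) y = x}"
        have s1: "(\<lambda>y. exp (potential z y) * g y) summable_on ?X"
          and s2: "(\<lambda>y. exp (potential z\<^sub>0 y) * g y) summable_on ?X"
          by (rule transfer_summable[OF fin _ g], rule Re)+
        have s3: "(\<lambda>y. exp (potential z\<^sub>0 y) * complex_of_real (\<xi> y) * g y) summable_on ?X"
          by (rule deriv_summable[OF g])
        have s12: "(\<lambda>y. exp (potential z y) * g y - exp (potential z\<^sub>0 y) * g y) summable_on ?X"
          using summable_on_add[OF s1 summable_on_uminus[THEN iffD2, OF s2]] by simp
        show "L z g x - L z\<^sub>0 g x - h * transfer_deriv z\<^sub>0 g x
            = kernel_op E 1 (\<lambda>y. exp (potential z\<^sub>0 y) * \<psi> (\<xi> y)) g x"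
          unfolding transfer_operator_eq_kernel_op transfer_deriv_def kernel_op_def kernel
          by (simp only: infsum_diff_complex[OF s12 summable_on_cmult_right[OF s3]]
              infsum_diff_complex[OF s1 s2] infsum_cmult_right')
      qed
    qed
  qed
qed

text \<open>
  Where the series converges in norm this is the inverse of \<open>Id - L\<^sub>z\<close>, that is, the resolvent of \<open>L\<^sub>z\<close> at the
  spectral parameter \<open>1\<close>.
\<close>

definition resolvent_at_one :: "complex \<Rightarrow> operator" where
  "resolvent_at_one z g x = (\<Sum>n. (L z ^^ n) g x)"

lemma resolvent_at_one:
  assumes fin: "partition_sum E (real_potential t) 1 \<noteq> \<infinity>" and sum: "summable (Z t)"
    and z: "Re z \<le> t" "norm z \<le> M"
  shows "bounded_op E \<theta> (\<Sum>n. 2 * ((1 + (1 + M) * V / (1 - \<theta>)) * Z t n)) (resolvent_at_one z)"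
    and "g \<in> H \<Longrightarrow> resolvent_at_one z (\<lambda>x. g x - L z g x) = g"
    and "g \<in> H \<Longrightarrow> (\<lambda>x. resolvent_at_one z g x - L z (resolvent_at_one z g) x) = g"
proof -
  have "summable (\<lambda>n. 2 * ((1 + (1 + M) * V / (1 - \<theta>)) * Z t n))"
    by (intro summable_mult sum)
  note N = neumann_series[OF transfer_bounded[OF fin z] transfer_funpow_bounded[OF fin z] this]
  have eq: "resolvent_at_one z = (\<lambda>g x. \<Sum>n. (L z ^^ n) g x)"
    by (simp add: resolvent_at_one_def fun_eq_iff)
  show "bounded_op E \<theta> (\<Sum>n. 2 * ((1 + (1 + M) * V / (1 - \<theta>)) * Z t n)) (resolvent_at_one z)"
    "g \<in> H \<Longrightarrow> resolvent_at_one z (\<lambda>x. g x - L z g x) = g"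
    "g \<in> H \<Longrightarrow> (\<lambda>x. resolvent_at_one z g x - L z (resolvent_at_one z g) x) = g"
    unfolding eq by (fact N)+
qed

text \<open>
  On a small disc about \<open>z\<^sub>0\<close> the real parts stay below some \<open>t < s\<close>, so one summable sequence of partition sums
  bounds all the Neumann series on the disc. This is the uniformity that the derivative of the resolvent
  needs.
\<close>

theorem resolvent_at_one_holomorphic:
  assumes below: "\<And>t. t < s \<Longrightarrow> partition_sum E (real_potential t) 1 \<noteq> \<infinity>" "\<And>t. t < s \<Longrightarrow> summable (Z t)"
  defines "T \<equiv> \<lambda>z g x. g x - L z g x"
  shows "\<And>z. Re z < s \<Longrightarrow> invertible_operator E \<theta> (T z)"
    and "operator_holomorphic_on E \<theta> (\<lambda>z. inverse_operator E \<theta> (T z)) {z. Re z < s}"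
proof -
  let ?R = resolvent_at_one
  have R: "bounded_op E \<theta> (\<Sum>n. 2 * ((1 + (1 + norm z) * V / (1 - \<theta>)) * Z (Re z) n)) (?R z)"
    "\<And>g. g \<in> H \<Longrightarrow> ?R z (T z g) = g" "\<And>g. g \<in> H \<Longrightarrow> T z (?R z g) = g"
    if "Re z < s" for z
    unfolding T_def using resolvent_at_one[OF below[OF that] order_refl order_refl] by auto
  show "invertible_operator E \<theta> (T z)" if z: "Re z < s" for z
    unfolding invertible_operator_def
  proof (intro conjI bexI[of _ "?R z"] ballI)
    show "T z \<in> bdd_operators E \<theta>"
      unfolding T_def
      by (rule bounded_op_mem_bdd_operators[OF bounded_op_diff[OF bounded_op_id
              transfer_bounded[OF below(1)[OF z] order_refl order_refl]]])
    show "?R z \<in> bdd_operators E \<theta>" by (rule bounded_op_mem_bdd_operators[OF R(1)[OF z]])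
  qed (use R(2,3)[OF z] in auto)
  have inverse: "inverse_operator E \<theta> (T z) g = ?R z g" if z: "Re z < s" and g: "g \<in> H" for z g
    by (rule inverse_operator_eq) (use R(2,3)[OF z] bounded_opD(2)[OF R(1)[OF z]] g in auto)
  show "operator_holomorphic_on E \<theta> (\<lambda>z. inverse_operator E \<theta> (T z)) {z. Re z < s}"
    unfolding operator_holomorphic_on_def
  proof (intro conjI ballI)
    fix z assume "z \<in> {z. Re z < s}"
    then have z: "Re z < s" by simp
    show "inverse_operator E \<theta> (T z) \<in> bdd_operators E \<theta>"
      by (rule bounded_op_mem_bdd_operators[OF bounded_op_cong[OF R(1)[OF z] inverse[OF z]]])
  next
    fix z\<^sub>0 assume "z\<^sub>0 \<in> {z. Re z < s}"
    then have z0: "Re z\<^sub>0 < s" by simp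
    \<comment> \<open>A quarter of the distance, because the estimate of the derivative uses \<open>3 r\<close> of it.\<close>
    define r where "r = (s - Re z\<^sub>0) / 4"
    define t where "t = Re z\<^sub>0 + 3 * r"
    have r: "0 < r" and t: "t < s" using z0 by (auto simp: r_def t_def field_simps)
    have near: "Re z \<le> t" "norm z \<le> norm z\<^sub>0 + r" if "norm (z - z\<^sub>0) \<le> r" for z
    proof -
      show "Re z \<le> t" using abs_Re_le_cmod[of "z - z\<^sub>0"] that r by (simp add: t_def)
      show "norm z \<le> norm z\<^sub>0 + r" using norm_triangle_sub[of z z\<^sub>0] that by linarith
    qed
    define S where "S = (\<Sum>n. 2 * ((1 + (1 + (norm z\<^sub>0 + r)) * V / (1 - \<theta>)) * Z t n))"
    define B where "B = 2 * ((1 + (1 + (norm z\<^sub>0 + r)) * V / (1 - \<theta>)) * Z t 1)"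
    have N: "bounded_op E \<theta> S (?R z)" "bounded_op E \<theta> B (L z)"
      "\<And>g. g \<in> H \<Longrightarrow> ?R z (\<lambda>x. g x - L z g x) = g"
      "\<And>g. g \<in> H \<Longrightarrow> (\<lambda>x. ?R z g x - L z (?R z g) x) = g"
      if z: "norm (z - z\<^sub>0) \<le> r" for z
      using resolvent_at_one[OF below[OF t] near[OF z]] transfer_bounded[OF below(1)[OF t] near[OF z]]
      unfolding S_def B_def by auto
    obtain K where K: "bounded_op E \<theta> K (transfer_deriv z\<^sub>0)"
      "\<And>z. norm (z - z\<^sub>0) \<le> r \<Longrightarrow> bounded_op E \<theta> (K / r * norm (z - z\<^sub>0) ^ 2)
        (\<lambda>g x. L z g x - L z\<^sub>0 g x - (z - z\<^sub>0) * transfer_deriv z\<^sub>0 g x)"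
      using transfer_differentiable[OF below(1)[OF t] r, of z\<^sub>0] by (auto simp: t_def)
    define R' where "R' = (\<lambda>g. ?R z\<^sub>0 (transfer_deriv z\<^sub>0 (?R z\<^sub>0 g)))"
    have lim: "((\<lambda>z. operator_norm E \<theta> (\<lambda>g x. (?R z g x - ?R z\<^sub>0 g x) / (z - z\<^sub>0) - R' g x)) \<longlongrightarrow> 0) (at z\<^sub>0)"
      unfolding R'_def
      by (rule resolvent_derivative[OF r, where L = L and S = S and B = B and D = K and K = "K / r"])
        (fact N K)+
    show "\<exists>R'\<in>bdd_operators E \<theta>. ((\<lambda>z. operator_norm E \<theta> (\<lambda>g x. (inverse_operator E \<theta> (T z) g x
        - inverse_operator E \<theta> (T z\<^sub>0) g x) / (z - z\<^sub>0) - R' g x)) \<longlongrightarrow> 0) (at z\<^sub>0 within {z. Re z < s})"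
    proof
      show "R' \<in> bdd_operators E \<theta>"
        unfolding R'_def
        by (rule bounded_op_mem_bdd_operators[OF bounded_op_comp[OF R(1)[OF z0]
                bounded_op_comp[OF K(1) R(1)[OF z0]]]])
      show "((\<lambda>z. operator_norm E \<theta> (\<lambda>g x. (inverse_operator E \<theta> (T z) g x
          - inverse_operator E \<theta> (T z\<^sub>0) g x) / (z - z\<^sub>0) - R' g x)) \<longlongrightarrow> 0) (at z\<^sub>0 within {z. Re z < s})"
      proof (rule Lim_transform_eventually[OF tendsto_within_subset[OF lim subset_UNIV]])
        show "\<forall>\<^sub>F z in at z\<^sub>0 within {z. Re z < s}.
            operator_norm E \<theta> (\<lambda>g x. (?R z g x - ?R z\<^sub>0 g x) / (z - z\<^sub>0) - R' g x)
            = operator_norm E \<theta> (\<lambda>g x. (inverse_operator E \<theta> (T z) g x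
                - inverse_operator E \<theta> (T z\<^sub>0) g x) / (z - z\<^sub>0) - R' g x)"
          unfolding eventually_at_filter
        proof (intro always_eventually allI impI)
          fix z assume "z \<in> {z. Re z < s}"
          then have z: "Re z < s" by simp
          show "operator_norm E \<theta> (\<lambda>g x. (?R z g x - ?R z\<^sub>0 g x) / (z - z\<^sub>0) - R' g x)
            = operator_norm E \<theta> (\<lambda>g x. (inverse_operator E \<theta> (T z) g x
                - inverse_operator E \<theta> (T z\<^sub>0) g x) / (z - z\<^sub>0) - R' g x)"
            by (rule operator_norm_cong) (simp add: inverse[OF z] inverse[OF z0])
        qed
      qed
    qed
  qed
qed

end

theorem proposition2p15:
  fixes I :: "nat set" and A :: "nat \<Rightarrow> nat \<Rightarrow> nat" and E :: "(nat \<Rightarrow> nat) set"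
    and \<theta> \<delta> :: real and \<eta> \<xi> :: "(nat \<Rightarrow> nat) \<Rightarrow> real"
  assumes incidence: "\<forall>i\<in>I. \<forall>j\<in>I. A i j \<in> {0, 1}"
    and irreducible: "finitely_irreducible I A"
    and E: "E = code_space I A"
    and theta: "0 < \<theta>" "\<theta> < 1"
    and eta: "\<eta> \<in> Holder_real E \<theta>"
    and xi: "\<xi> \<in> Holder_real E \<theta>" "\<forall>\<omega>\<in>E. 0 \<le> \<xi> \<omega>"
    and unique_zero: "\<exists>!d::real. pressure E (\<lambda>\<omega>. \<eta> \<omega> - d * \<xi> \<omega>) = 0"
    and delta: "pressure E (\<lambda>\<omega>. \<eta> \<omega> - \<delta> * \<xi> \<omega>) = 0"
  shows "(\<forall>z. Re z < - \<delta> \<longrightarrow> invertible_operator E \<theta> (id_minus_transfer E \<eta> \<xi> z)) \<and>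
    operator_holomorphic_on E \<theta> (\<lambda>z. inverse_operator E \<theta> (id_minus_transfer E \<eta> \<xi> z))
      {z. Re z < - \<delta>}"
proof -
  interpret holder_shift I A E \<theta> by unfold_locales (use E theta in auto)
  obtain V1 where V1: "0 \<le> V1" "\<And>n x y. n \<ge> 1 \<Longrightarrow> x \<in> E \<Longrightarrow> y \<in> E \<Longrightarrow> (\<And>i. i < n \<Longrightarrow> x i = y i)
      \<Longrightarrow> \<bar>\<eta> x - \<eta> y\<bar> \<le> V1 * \<theta> ^ n" using Holder_realE[OF eta] by blast
  obtain V2 where V2: "0 \<le> V2" "\<And>n x y. n \<ge> 1 \<Longrightarrow> x \<in> E \<Longrightarrow> y \<in> E \<Longrightarrow> (\<And>i. i < n \<Longrightarrow> x i = y i)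
      \<Longrightarrow> \<bar>\<xi> x - \<xi> y\<bar> \<le> V2 * \<theta> ^ n" using Holder_realE[OF xi(1)] by blast
  define V where "V = max V1 V2"
  have V: "V1 * \<theta> ^ n \<le> V * \<theta> ^ n" "V2 * \<theta> ^ n \<le> V * \<theta> ^ n" for n
    using theta by (auto simp: V_def intro!: mult_right_mono)
  interpret potential_family I A E \<theta> \<eta> \<xi> V
  proof unfold_locales
    show "0 \<le> V" using V1(1) by (simp add: V_def)
    show "\<bar>\<eta> x - \<eta> y\<bar> \<le> V * \<theta> ^ n" "\<bar>\<xi> x - \<xi> y\<bar> \<le> V * \<theta> ^ n"
      if "n \<ge> 1" "x \<in> E" "y \<in> E" "\<And>i. i < n \<Longrightarrow> x i = y i" for n x y
      using V1(2)[OF that] V2(2)[OF that] V[of n] by linarith+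
  qed (use xi(2) in auto)
  have potential_eq: "real_potential (- d) = (\<lambda>\<omega>. \<eta> \<omega> - d * \<xi> \<omega>)" for d
    by (simp add: real_potential_def fun_eq_iff)
  have zero: "pressure E (real_potential (- \<delta>)) = 0" using delta by (simp add: potential_eq)
  have unique: "t = - \<delta>" if "pressure E (real_potential t) = 0" for t
  proof -
    have "pressure E (\<lambda>\<omega>. \<eta> \<omega> - (- t) * \<xi> \<omega>) = 0" using that potential_eq[of "- t"] by simp
    then have "- t = \<delta>" using unique_zero delta by blast
    then show ?thesis by simp
  qed
  have T: "id_minus_transfer E \<eta> \<xi> z = (\<lambda>g x. g x - L z g x)" for z
    by (simp add: id_minus_transfer_def potential_def[abs_def])
  have below: "partition_sum E (real_potential t) 1 \<noteq> \<infinity>" "summable (Z t)" if "t < - \<delta>" for t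
    using summable_below_unique_zero[OF irreducible zero _ that] unique by blast+
  show ?thesis
    unfolding T using resolvent_at_one_holomorphic[of "- \<delta>"] below by blast
qed

end
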